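(* Let $n$ be a positive integer, let $0<\alpha<n$, and set $\alpha^*=\frac{n+\alpha}{n-\alpha}$. If $p<\alpha^*$, then there does not exist any regular positive solution $u$ of the integral equation $$u(x)=\int_{\mathbb{R}^n}\frac{1}{|x-y|^{n-\alpha}}\,u(y)^p\,dy,\qquad x\in\mathbb{R}^n.$$
   Context: $p$ is a real exponent. A positive solution is a positive measurable function $u$ for which the integral on the right-hand side is finite and equal to $u(x)$. A point is a singularity of $u$ if $u$ is unbounded in every neighbourhood of it. A solution is regular if it has no singularities, i.e. $u:\mathbb{R}^n\to(0,\infty)$ is locally bounded and the equation holds at every $x\in\mathbb{R}^n$. *)

theory Defs
  imports "HOL-Analysis.Analysis"
begin

definition singularity :: "('a::topological_space \<Rightarrow> real) \<Rightarrow> 'a \<Rightarrow> bool" where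
  "singularity u x \<longleftrightarrow> (\<forall>U. open U \<and> x \<in> U \<longrightarrow> \<not> bounded (u ` U))"

(* At y = x the kernel takes the value 1 / 0 powr _ = 0, which is irrelevant since points are
   null sets. *)
definition riesz_kernel :: "real \<Rightarrow> real ^ 'n \<Rightarrow> real ^ 'n \<Rightarrow> real" where
  "riesz_kernel \<alpha> x y = 1 / norm (x - y) powr (real CARD('n) - \<alpha>)"

(* has_bochner_integral states both that the integral (of a nonnegative function) is finite and
   that its value is u x. *)
definition regular_positive_solution :: "real \<Rightarrow> real \<Rightarrow> (real ^ 'n \<Rightarrow> real) \<Rightarrow> bool" where
  "regular_positive_solution \<alpha> p u \<longleftrightarrow>
     u \<in> borel_measurable lebesgue \<and>
     (\<forall>x. 0 < u x) \<and>
     (\<forall>x. has_bochner_integral lebesgue (\<lambda>y. riesz_kernel \<alpha> x y * u y powr p) (u x)) \<and>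
     (\<forall>x. \<not> singularity u x)"

end

theory Submission imports Defs begin

text \<open>
  The proof is the method of moving spheres, carried out on the integral equation itself, inside the
  spheres, and with nothing but the supremum norm.

  Write \<open>n\<close> for the dimension and \<open>s = n - \<alpha>\<close>. For \<open>r > 0\<close> let \<open>\<iota> z = (r / |z|)\<^sup>2 z\<close> be inversion in the
  sphere of radius \<open>r\<close> around the origin and let \<open>u\<^sub>r z = (r / |z|)^s u (\<iota> z)\<close> be the Kelvin transform of
  \<open>u\<close>. Suppose first that \<open>p > 0\<close>; then \<open>u\<close> is continuous
  (\<open>continuous_on_regular_positive_solution\<close>). Inversion folds the part of the integral outside the
  sphere onto the inside, and \<open>kelvin_difference\<close> gives, for \<open>0 < |x| < r\<close>,
  \<open>u x - u\<^sub>r x = \<integral>\<^bsub>|z| < r\<^esub> K x z (u z ^ p - (r / |z|)^(n + \<alpha>) u (\<iota> z) ^ p) dz\<close>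
  with a kernel \<open>K\<close> that is positive and at most \<open>1 / |x - z|^s\<close>. Subcriticality means
  \<open>n + \<alpha> > p s\<close>, so the subtracted term is strictly larger than \<open>u\<^sub>r z ^ p\<close>: the
  integrand is negative wherever \<open>u \<le> u\<^sub>r\<close>, and elsewhere at most a constant times \<open>K (u - u\<^sub>r)\<close>.

  Two consequences carry the argument. If \<open>u \<le> u\<^sub>r\<close> in the whole ball, then \<open>u < u\<^sub>r\<close> there
  (\<open>kelvin_comparison_strict\<close>). If the set where \<open>u > u\<^sub>r\<close> has small measure, it is empty, because the
  formula makes the supremum of \<open>u - u\<^sub>r\<close> over it at most half of itself
  (\<open>kelvin_comparison_small_bad_set\<close>); this uses only that \<open>1 / |x - z|^s\<close> has a small integral over
  sets of small measure, uniformly in \<open>x\<close>. When \<open>r\<close> decreases to a radius \<open>\<rho>\<close> with \<open>u < u\<^sub>\<rho>\<close>, the measure of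
  that set tends to \<open>0\<close>. So the radii for which the comparison holds can never stop, and \<open>u \<le> u\<^sub>r\<close>
  inside every sphere (\<open>kelvin_comparison\<close>). The case \<open>\<rho> = 0\<close> of the same step starts the process.

  Translates of solutions are solutions, so the comparison holds around every centre. Two given
  points are exchanged by inversions whose centres recede to infinity along the line through them,
  and the conformal factor tends to \<open>1\<close>; hence \<open>u\<close> is constant (\<open>equal_everywhere\<close>), and the
  potential of a constant diverges.

  For \<open>p \<le> 0\<close> the comparison argument is not available, but mean values are. By Tonelli the mean of
  \<open>u\<close> over large balls stays bounded (\<open>nn_integral_solution_ball_le\<close>), so \<open>u\<close> is bounded on a fixed
  portion of each ball and \<open>u ^ p\<close> is bounded below there, whereas finiteness of the potential at \<open>0\<close>
  forces the mean of \<open>u ^ p\<close> over the ball of radius \<open>R\<close> to be \<open>O(R^(-\<alpha>))\<close>.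
\<close>

section \<open>Reindexing coordinates\<close>

text \<open>
  Changing variables in a multiple integral proceeds coordinate by coordinate, in some order. This copy
  of a type carries an order transported from the natural numbers; renaming coordinates preserves
  Lebesgue measure, so results about the copy move back to the original index type.
\<close>

typedef 'a well_ordered = "UNIV :: 'a set" ..

instance well_ordered :: (finite) finite
proof
  have "(UNIV :: 'a well_ordered set) = range Abs_well_ordered"
    by (metis Rep_well_ordered_inverse surjI)
  then show "finite (UNIV :: 'a well_ordered set)"
    by (metis finite finite_imageI)
qed

instantiation well_ordered :: (finite) wellorder
begin

definition less_eq_well_ordered :: "'a well_ordered \<Rightarrow> 'a well_ordered \<Rightarrow> bool"
  where "x \<le> y \<longleftrightarrow> to_nat (Rep_well_ordered x) \<le> to_nat (Rep_well_ordered y)"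

definition less_well_ordered :: "'a well_ordered \<Rightarrow> 'a well_ordered \<Rightarrow> bool"
  where "x < y \<longleftrightarrow> to_nat (Rep_well_ordered x) < to_nat (Rep_well_ordered y)"

instance
proof
  fix P :: "'a well_ordered \<Rightarrow> bool" and a
  assume step: "\<And>x. (\<And>y. y < x \<Longrightarrow> P y) \<Longrightarrow> P x"
  show "P a"
    by (induction a rule: measure_induct_rule[where f = "\<lambda>x. to_nat (Rep_well_ordered x)"])
       (auto intro: step simp: less_well_ordered_def)
qed (auto simp: less_eq_well_ordered_def less_well_ordered_def Rep_well_ordered_inject)

end

definition reindex :: "('b \<Rightarrow> 'a) \<Rightarrow> 'c ^ 'a \<Rightarrow> 'c ^ 'b"
  where "reindex h x = (\<chi> i. x $ h i)"

lemma linear_reindex: "linear (reindex h :: real ^ 'a::finite \<Rightarrow> real ^ 'b::finite)"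
  by (rule linearI) (simp_all add: reindex_def vec_eq_iff)

lemma norm_reindex:
  fixes x :: "real ^ 'a::finite" and h :: "'b::finite \<Rightarrow> 'a"
  assumes "bij h"
  shows "norm (reindex h x) = norm x"
  unfolding norm_vec_def L2_set_def reindex_def
  using sum.reindex_bij_betw[OF assms, of "\<lambda>i. (norm (x $ i))\<^sup>2"] by simp

lemma borel_measurable_reindex [measurable]:
  "(reindex h :: real ^ 'a::finite \<Rightarrow> real ^ 'b::finite) \<in> borel_measurable borel"
  by (intro borel_measurable_continuous_onI linear_continuous_on linear_conv_bounded_linear[THEN iffD1] linear_reindex)

lemma distr_lborel_reindex:
  assumes "bij (h :: 'b::finite \<Rightarrow> 'a::finite)"
  shows "distr lborel borel (reindex h :: real ^ 'a \<Rightarrow> real ^ 'b) = lborel"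
proof (rule lborel_eqI[symmetric])
  fix l u :: "real ^ 'b"
  assume le: "\<And>b. b \<in> Basis \<Longrightarrow> l \<bullet> b \<le> u \<bullet> b"
  have le': "l $ i \<le> u $ i" for i
    using le[of "axis i 1"] by (simp add: cart_eq_inner_axis axis_in_Basis_iff)
  let ?g = "reindex (inv h) :: real ^ 'b \<Rightarrow> real ^ 'a"
  have inv: "h (inv h i) = i" "inv h (h j) = j" for i j
    using assms by (auto simp: bij_def surj_f_inv_f)
  have vim: "reindex h -` box l u = box (?g l) (?g u)"
    by (auto simp: mem_box_cart reindex_def inv) (metis inv)+
  have "emeasure (distr lborel borel (reindex h)) (box l u) = emeasure lborel (box (?g l) (?g u))"
    by (subst emeasure_distr) (auto simp: vim)
  also have "\<dots> = (\<Prod>b\<in>Basis. (?g u - ?g l) \<bullet> b)"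
    using le' by (subst emeasure_lborel_box) (auto simp: Basis_vec_def reindex_def inner_axis)
  also have "(\<Prod>b\<in>Basis. (?g u - ?g l) \<bullet> b) = (\<Prod>i\<in>UNIV. (u - l) $ inv h i)"
    by (simp add: Basis_vec_def cart_eq_inner_axis[symmetric] prod.UNION_disjoint reindex_def
        UNION_singleton_eq_range prod.reindex inj_on_def axis_eq_axis inner_axis)
  also have "\<dots> = (\<Prod>i\<in>UNIV. (u - l) $ i)"
    using prod.reindex_bij_betw[OF bij_imp_bij_inv[OF assms], of "\<lambda>i. (u - l) $ i"] by simp
  also have "\<dots> = (\<Prod>b\<in>Basis. (u - l) \<bullet> b)"
    by (simp add: Basis_vec_def cart_eq_inner_axis[symmetric] prod.UNION_disjoint reindex_def
        UNION_singleton_eq_range prod.reindex inj_on_def axis_eq_axis inner_axis)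
  finally show "emeasure (distr lborel borel (reindex h)) (box l u) = (\<Prod>b\<in>Basis. (u - l) \<bullet> b)" .
qed simp

section \<open>Inversion in a sphere as a change of variables\<close>

definition inversion :: "real \<Rightarrow> 'a::real_normed_vector \<Rightarrow> 'a"
  where "inversion r z = (r\<^sup>2 / (norm z)\<^sup>2) *\<^sub>R z"

lemma inversion_nonzero: "0 < r \<Longrightarrow> z \<noteq> 0 \<Longrightarrow> inversion r z \<noteq> 0"
  by (simp add: inversion_def)

lemma norm_inversion: "norm (inversion r z) = r\<^sup>2 / norm z"
  by (simp add: inversion_def power2_eq_square)

lemma inversion_involution: "0 < r \<Longrightarrow> z \<noteq> 0 \<Longrightarrow> inversion r (inversion r z) = z"
  by (simp add: inversion_def power2_eq_square field_simps)

lemma image_inversion_ball: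
  assumes "0 < r"
  shows "inversion r ` (ball 0 r - {0}) = - cball (0 :: 'a::real_normed_vector) r"
proof (intro equalityI subsetI)
  fix y :: 'a assume y: "y \<in> - cball 0 r"
  then have y0: "y \<noteq> 0" using assms by auto
  have "r * r < r * norm y"
    using y assms by (intro mult_strict_left_mono) auto
  then have "inversion r y \<in> ball 0 r - {0}"
    using y0 inversion_nonzero[OF assms y0]
    by (simp add: norm_inversion divide_less_eq power2_eq_square)
  then show "y \<in> inversion r ` (ball 0 r - {0})"
    using inversion_involution[OF assms y0] by (metis imageI)
next
  fix y :: 'a assume "y \<in> inversion r ` (ball 0 r - {0})"
  then show "y \<in> - cball 0 r" using assms
    by (auto simp: norm_inversion field_simps power2_eq_square)
qed

lemma inj_on_inversion: "0 < r \<Longrightarrow> inj_on (inversion r) (- {0})"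
  by (metis ComplD inj_on_inverseI inversion_involution singletonI)

lemma has_derivative_inversion:
  fixes z :: "'a::real_inner"
  assumes "z \<noteq> 0"
  shows "(inversion r has_derivative
           (\<lambda>h. (r\<^sup>2 / (norm z)\<^sup>2) *\<^sub>R (h - (2 * (z \<bullet> h) / (z \<bullet> z)) *\<^sub>R z))) (at z within S)"
proof -
  have "((\<lambda>z. (r\<^sup>2 / (z \<bullet> z)) *\<^sub>R z) has_derivative
           (\<lambda>h. (r\<^sup>2 / (z \<bullet> z)) *\<^sub>R (h - (2 * (z \<bullet> h) / (z \<bullet> z)) *\<^sub>R z))) (at z within S)"
    using assms
    by (auto intro!: derivative_eq_intros ext
        simp: field_simps power2_eq_square inner_commute scaleR_diff_right)
  then show ?thesis
    by (simp add: inversion_def[abs_def] power2_norm_eq_inner)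
qed

lemma orthogonal_transformation_reflection:
  assumes "z \<noteq> 0"
  shows "orthogonal_transformation (\<lambda>h. h - (2 * (z \<bullet> h) / (z \<bullet> z)) *\<^sub>R z)"
proof -
  have "linear (\<lambda>h. h - (2 * (z \<bullet> h) / (z \<bullet> z)) *\<^sub>R z)"
    by (rule linearI) (auto simp: algebra_simps inner_add_right add_divide_distrib)
  moreover have "(v - (2 * (z \<bullet> v) / (z \<bullet> z)) *\<^sub>R z) \<bullet> (w - (2 * (z \<bullet> w) / (z \<bullet> z)) *\<^sub>R z) = v \<bullet> w" for v w
    using assms by (simp add: inner_diff inner_commute field_simps)
  ultimately show ?thesis by (simp add: orthogonal_transformation_def)
qed

text \<open>
  The derivative of inversion is a dilation composed with a reflection, so the absolute value of the
  Jacobian is read off without expanding a determinant.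
\<close>

lemma det_derivative_inversion:
  fixes z :: "real ^ 'n::finite"
  assumes "z \<noteq> 0"
  shows "\<bar>det (matrix (\<lambda>h. (r\<^sup>2 / (norm z)\<^sup>2) *\<^sub>R (h - (2 * (z \<bullet> h) / (z \<bullet> z)) *\<^sub>R z)))\<bar>
           = (r / norm z) ^ (2 * CARD('n))"
proof -
  let ?T = "\<lambda>h. h - (2 * (z \<bullet> h) / (z \<bullet> z)) *\<^sub>R z" and ?c = "r\<^sup>2 / (norm z)\<^sup>2"
  have T: "orthogonal_transformation ?T"
    by (rule orthogonal_transformation_reflection[OF assms])
  have "matrix (\<lambda>h. ?c *\<^sub>R ?T h) = matrix ((*\<^sub>R) ?c) ** matrix ?T"
    using matrix_compose[OF orthogonal_transformation_linear[OF T]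
        bounded_linear.linear[OF bounded_linear_scaleR_right[of ?c]]]
    by (simp add: o_def del: scaleR_diff_right)
  then have "\<bar>det (matrix (\<lambda>h. ?c *\<^sub>R ?T h))\<bar> = \<bar>?c ^ CARD('n)\<bar> * \<bar>det (matrix ?T)\<bar>"
    by (simp add: det_mul abs_mult del: scaleR_diff_right)
  also have "\<dots> = (r / norm z) ^ (2 * CARD('n))"
    using T by (simp add: power_mult power_divide)
  finally show ?thesis .
qed

lemma absolutely_integrable_inversion_wellorder:
  fixes f :: "real ^ 'm::{finite,wellorder} \<Rightarrow> real"
  assumes "0 < r" and f: "f absolutely_integrable_on (- cball 0 r)"
  shows "(\<lambda>z. (r / norm z) ^ (2 * CARD('m)) * f (inversion r z)) absolutely_integrable_on (ball 0 r - {0})"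
        (is ?A)
    and "integral (ball 0 r - {0}) (\<lambda>z. (r / norm z) ^ (2 * CARD('m)) * f (inversion r z))
           = integral (- cball 0 r) f" (is ?B)
proof -
  let ?S = "ball 0 r - {0} :: (real ^ 'm::_) set"
  let ?D = "\<lambda>z h. (r\<^sup>2 / (norm z)\<^sup>2) *\<^sub>R (h - (2 * (z \<bullet> h) / (z \<bullet> z)) *\<^sub>R z)"
  let ?f = "\<lambda>z. vec (f z) :: real ^ 1"
  have S: "?S \<in> sets lebesgue" by auto
  have inj: "inj_on (inversion r) ?S"
    by (rule inj_on_subset[OF inj_on_inversion[OF \<open>0 < r\<close>]]) auto
  have "(\<lambda>z. \<bar>det (matrix (?D z))\<bar> *\<^sub>R ?f (inversion r z)) absolutely_integrable_on ?S \<and>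
     integral ?S (\<lambda>z. \<bar>det (matrix (?D z))\<bar> *\<^sub>R ?f (inversion r z)) = vec (integral (- cball 0 r) f)"
    using f has_absolute_integral_change_of_variables[OF S _ inj, of ?D ?f "vec (integral (- cball 0 r) f)"]
    by (simp add: has_derivative_inversion image_inversion_ball[OF \<open>0 < r\<close>]
        absolutely_integrable_on_1_iff integral_on_1_eq)
  moreover have "\<bar>det (matrix (?D z))\<bar> = (r / norm z) ^ (2 * CARD('m))" if "z \<in> ?S" for z
    using that by (intro det_derivative_inversion) auto
  ultimately have "(\<lambda>z. (r / norm z) ^ (2 * CARD('m)) *\<^sub>R ?f (inversion r z)) absolutely_integrable_on ?S \<and>
     integral ?S (\<lambda>z. (r / norm z) ^ (2 * CARD('m)) *\<^sub>R ?f (inversion r z)) = vec (integral (- cball 0 r) f)"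
    by (smt (verit, best) integral_cong set_integrable_cong)
  then show ?A ?B
    by (simp_all add: absolutely_integrable_on_1_iff integral_on_1_eq vec_eq_iff)
qed

lemma borel_measurable_inversion [measurable]:
  "inversion r \<in> borel_measurable (borel :: 'a::euclidean_space measure)"
  unfolding inversion_def[abs_def] by measurable

lemma bij_Rep_well_ordered: "bij Rep_well_ordered" and bij_Abs_well_ordered: "bij Abs_well_ordered"
  by (metis Abs_well_ordered_inverse Rep_well_ordered_inverse UNIV_I bij_betw_def inj_def surj_def)+

text \<open>
  For Borel functions on an arbitrary finite index type: the integral over the exterior of a
  ball, pulled back to the punctured ball.
\<close>

lemma has_bochner_integral_inversion:
  fixes f :: "real ^ 'n::finite \<Rightarrow> real"
  assumes r: "0 < r" and f: "integrable lborel f"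
  shows "has_bochner_integral lborel
           (\<lambda>z. indicator (ball 0 r - {0}) z * ((r / norm z) ^ (2 * CARD('n)) * f (inversion r z)))
           (\<integral>y. indicator (- cball 0 r) y * f y \<partial>lborel)"
proof -
  let ?\<phi> = "reindex Rep_well_ordered :: real ^ 'n \<Rightarrow> real ^ 'n well_ordered"
  let ?\<psi> = "reindex Abs_well_ordered :: real ^ 'n well_ordered \<Rightarrow> real ^ 'n"
  define g where "g = (\<lambda>y. f (?\<psi> y))"
  have [measurable]: "f \<in> borel_measurable borel"
    using f by auto
  have [measurable]: "g \<in> borel_measurable borel"
    unfolding g_def by measurable
  have \<psi>\<phi>: "?\<psi> (?\<phi> x) = x" for x
    by (simp add: reindex_def vec_eq_iff Abs_well_ordered_inverse)
  have \<phi>inv: "inversion r (?\<phi> z) = ?\<phi> (inversion r z)" for z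
    by (simp add: inversion_def norm_reindex[OF bij_Rep_well_ordered] linear_cmul[OF linear_reindex])
  have card: "CARD('n well_ordered) = CARD('n)"
    using bij_betw_same_card[OF bij_Rep_well_ordered] by simp
  have d\<phi>: "distr lborel borel ?\<phi> = lborel"
    by (rule distr_lborel_reindex[OF bij_Rep_well_ordered])
  have d\<psi>: "distr lborel borel ?\<psi> = lborel"
    by (rule distr_lborel_reindex[OF bij_Abs_well_ordered])
  have "integrable lborel g"
    unfolding g_def using f integrable_distr_eq[of ?\<psi> lborel borel f] by (simp add: d\<psi>)
  then have g: "integrable lebesgue g"
    by (simp add: integrable_completion)
  then have gS: "g absolutely_integrable_on (- cball 0 r)"
    unfolding set_integrable_def by (intro integrable_mult_indicator) auto
  let ?h = "\<lambda>z. (r / norm z) ^ (2 * CARD('n)) * g (inversion r z)"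
  have A: "?h absolutely_integrable_on (ball 0 r - {0})"
    and B: "integral (ball 0 r - {0}) ?h = integral (- cball 0 r) g"
    using absolutely_integrable_inversion_wellorder[OF r gS] by (simp_all add: card)
  have [measurable]: "ball 0 r - {0} \<in> sets (borel :: (real ^ 'n well_ordered) measure)"
    by auto
  have meas: "(\<lambda>z. indicator (ball 0 r - {0}) z * ?h z) \<in> borel_measurable borel"
    by measurable
  have C: "(\<integral>z. indicator (ball 0 r - {0}) z * ?h z \<partial>lborel) = (\<integral>y. indicator (- cball 0 r) y * g y \<partial>lborel)"
    using B set_lebesgue_integral_eq_integral(2)[OF A] set_lebesgue_integral_eq_integral(2)[OF gS]
    using meas by (simp add: set_lebesgue_integral_def integral_completion)
  have D: "integrable lborel (\<lambda>z. indicator (ball 0 r - {0}) z * ?h z)"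
    using A meas by (simp add: set_integrable_def integrable_completion)
  have E: "indicator (ball 0 r - {0}) (?\<phi> z) = (indicator (ball 0 r - {0}) z :: real)"
      "indicator (- cball 0 r) (?\<phi> z) = (indicator (- cball 0 r) z :: real)" for z
    using norm_reindex[OF bij_Rep_well_ordered, of z]
    by (auto simp: indicator_def)
  have "(\<integral>z. indicator (ball 0 r - {0}) z * ((r / norm z) ^ (2 * CARD('n)) * f (inversion r z)) \<partial>lborel)
      = (\<integral>z. indicator (ball 0 r - {0}) z * ?h z \<partial>distr lborel borel ?\<phi>)"
    by (subst integral_distr) (auto simp: E norm_reindex[OF bij_Rep_well_ordered] \<phi>inv g_def \<psi>\<phi>)
  also have "\<dots> = (\<integral>y. indicator (- cball 0 r) y * g y \<partial>distr lborel borel ?\<phi>)"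
    unfolding d\<phi> by (rule C)
  also have "\<dots> = (\<integral>y. indicator (- cball 0 r) y * f y \<partial>lborel)"
    by (subst integral_distr) (auto simp: E g_def \<psi>\<phi>)
  finally have 1: "(\<integral>z. indicator (ball 0 r - {0}) z * ((r / norm z) ^ (2 * CARD('n)) * f (inversion r z)) \<partial>lborel)
      = (\<integral>y. indicator (- cball 0 r) y * f y \<partial>lborel)" .
  have "integrable (distr lborel borel ?\<phi>) (\<lambda>z. indicator (ball 0 r - {0}) z * ?h z)"
    unfolding d\<phi> by (rule D)
  then have "integrable lborel (\<lambda>z. indicator (ball 0 r - {0}) z * ((r / norm z) ^ (2 * CARD('n)) * f (inversion r z)))"
    by (subst (asm) integrable_distr_eq) (auto simp: E norm_reindex[OF bij_Rep_well_ordered] \<phi>inv g_def \<psi>\<phi>)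
  with 1 show ?thesis
    by (simp add: has_bochner_integral_iff)
qed

section \<open>The Riesz kernel\<close>

lemma ball_in_sets_borel [measurable]: "ball (x :: 'a::metric_space) r \<in> sets borel"
  by simp

lemma riesz_kernel_nonneg: "0 \<le> riesz_kernel \<alpha> x y"
  by (simp add: riesz_kernel_def)

lemma riesz_kernel_pos: "x \<noteq> y \<Longrightarrow> 0 < riesz_kernel \<alpha> x y"
  by (simp add: riesz_kernel_def)

lemma riesz_kernel_commute: "riesz_kernel \<alpha> x y = riesz_kernel \<alpha> y x"
  by (simp add: riesz_kernel_def norm_minus_commute)

lemma riesz_kernel_antimono:
  fixes x y :: "real ^ 'n::finite"
  assumes "\<alpha> < real CARD('n)" and "0 < R" and "R \<le> norm (x - y)"
  shows "riesz_kernel \<alpha> x y \<le> R powr (\<alpha> - real CARD('n))"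
proof -
  have pos: "0 < norm (x - y)" using assms by linarith
  have "R powr (real CARD('n) - \<alpha>) \<le> norm (x - y) powr (real CARD('n) - \<alpha>)"
    using assms by (intro powr_mono2) auto
  then have "riesz_kernel \<alpha> x y \<le> 1 / R powr (real CARD('n) - \<alpha>)"
    unfolding riesz_kernel_def using assms pos by (intro divide_left_mono mult_pos_pos) auto
  then show ?thesis
    by (simp add: powr_minus_divide[symmetric])
qed

lemma riesz_kernel_ge:
  fixes x y :: "real ^ 'n::finite"
  assumes "\<alpha> < real CARD('n)" and "x \<noteq> y" and "norm (x - y) \<le> R"
  shows "R powr (\<alpha> - real CARD('n)) \<le> riesz_kernel \<alpha> x y"
proof -
  have pos: "0 < norm (x - y)" "0 < R" using assms by (simp, smt (verit) zero_less_norm_iff right_minus_eq)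
  have "norm (x - y) powr (real CARD('n) - \<alpha>) \<le> R powr (real CARD('n) - \<alpha>)"
    using assms by (intro powr_mono2) auto
  then have "1 / R powr (real CARD('n) - \<alpha>) \<le> riesz_kernel \<alpha> x y"
    unfolding riesz_kernel_def using assms pos by (intro divide_left_mono mult_pos_pos) auto
  then show ?thesis
    by (simp add: powr_minus_divide[symmetric])
qed

lemma borel_measurable_riesz_kernel [measurable (raw)]:
  assumes "f \<in> borel_measurable M" "g \<in> borel_measurable M"
  shows "(\<lambda>w. riesz_kernel \<alpha> (f w) (g w)) \<in> borel_measurable M"
  unfolding riesz_kernel_def using assms by measurable

text \<open>
  Compare the kernel with a step function on the dyadic balls of radius \<open>2^(-k) r\<close>: on each shell the
  kernel is at most its value at the inner radius, and the resulting series is geometric with ratio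
  \<open>2^(-\<alpha>)\<close>. This is where \<open>\<alpha> > 0\<close> makes the singularity integrable.
\<close>

lemma nn_integral_riesz_kernel_ball:
  assumes "0 < \<alpha>" and "\<alpha> < real CARD('n::finite)"
  obtains C where "0 < C"
    and "\<And>(x :: real ^ 'n) r. 0 < r \<Longrightarrow>
           (\<integral>\<^sup>+y. ennreal (riesz_kernel \<alpha> x y) * indicator (ball x r) y \<partial>lborel) \<le> ennreal (C * r powr \<alpha>)"
proof -
  let ?n = "real CARD('n)"
  define \<omega> where "\<omega> = measure lborel (ball (0 :: real ^ 'n) 1)"
  have \<omega>: "0 < \<omega>" unfolding \<omega>_def by (rule content_ball_pos) simp
  define q where "q = (1/2 :: real) powr \<alpha>"
  have q: "0 < q" "q < 1"
    using powr_less_mono2[of \<alpha> "1/2" 1] \<open>0 < \<alpha>\<close> by (auto simp: q_def)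
  define C where "C = 2 powr (?n - \<alpha>) * \<omega> / (1 - q)"
  have "(\<integral>\<^sup>+y. ennreal (riesz_kernel \<alpha> x y) * indicator (ball x r) y \<partial>lborel) \<le> ennreal (C * r powr \<alpha>)"
    if r: "0 < r" for x :: "real ^ 'n" and r
  proof -
    define a where "a k = ((1/2) ^ Suc k * r) powr (\<alpha> - ?n)" for k :: nat
    have "ennreal (riesz_kernel \<alpha> x y) * indicator (ball x r) y
        \<le> (\<Sum>k. ennreal (a k) * indicator (ball x ((1/2) ^ k * r)) y)" (is "?l \<le> suminf ?t") for y
    proof (cases "y \<in> ball x r \<and> y \<noteq> x")
      case True
      let ?P = "\<lambda>k. (1/2) ^ Suc k * r \<le> norm (x - y)"
      obtain m where "(1/2 :: real) ^ m < norm (x - y) / r"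
        using True r real_arch_pow_inv[of "norm (x - y) / r" "1/2"] by auto
      then have "?P m" using r by (simp add: field_simps)
      define k where "k = (LEAST k. ?P k)"
      have k: "?P k" unfolding k_def by (rule LeastI[of ?P, OF \<open>?P m\<close>])
      have "norm (x - y) < (1/2) ^ k * r"
      proof (cases k)
        case 0 then show ?thesis using True by (simp add: dist_norm)
      next
        case (Suc j)
        then have "\<not> ?P j" unfolding k_def by (intro not_less_Least) simp
        then show ?thesis using Suc by simp
      qed
      then have "?l \<le> ?t k"
        using True k r riesz_kernel_antimono[OF assms(2) _ k]
        by (simp add: a_def dist_norm ennreal_leI)
      also have "\<dots> \<le> suminf ?t"
      proof -
        have "sum g {k} = g k" for g :: "nat \<Rightarrow> ennreal" by simp
        then show ?thesis using sum_le_suminf[of ?t "{k}", OF summableI] by (metis finite.emptyI finite_insert zero_le)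
      qed
      finally show ?thesis .
    qed (auto simp: riesz_kernel_def)
    then have "(\<integral>\<^sup>+y. ennreal (riesz_kernel \<alpha> x y) * indicator (ball x r) y \<partial>lborel)
        \<le> (\<integral>\<^sup>+y. (\<Sum>k. ennreal (a k) * indicator (ball x ((1/2) ^ k * r)) y) \<partial>lborel)"
      by (rule nn_integral_mono)
    also have "\<dots> = (\<Sum>k. \<integral>\<^sup>+y. ennreal (a k) * indicator (ball x ((1/2) ^ k * r)) y \<partial>lborel)"
      by (intro nn_integral_suminf) measurable
    also have "\<dots> = (\<Sum>k. ennreal (2 powr (?n - \<alpha>) * \<omega> * r powr \<alpha> * q ^ k))"
    proof (intro arg_cong[of _ _ suminf] ext)
      fix k
      let ?R = "(1/2) ^ k * r"
      have R: "0 < ?R" using r by simp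
      have "emeasure lborel (ball x ?R) = ennreal (?R ^ CARD('n) * \<omega>)"
        using emeasure_lborel_ball_finite[of x ?R] content_ball_conv_unit_ball[of ?R x] R
        by (subst emeasure_eq_ennreal_measure) (auto simp: \<omega>_def)
      then have "(\<integral>\<^sup>+y. ennreal (a k) * indicator (ball x ?R) y \<partial>lborel) = ennreal (a k * (?R ^ CARD('n) * \<omega>))"
        using \<omega> r by (subst nn_integral_cmult_indicator) (auto simp: ennreal_mult a_def)
      also have "a k * (?R ^ CARD('n) * \<omega>) = 2 powr (?n - \<alpha>) * \<omega> * ?R powr \<alpha>"
      proof -
        have "a k = (1/2 * ?R) powr (\<alpha> - ?n)" by (simp add: a_def)
        also have "\<dots> = (1/2) powr (\<alpha> - ?n) * ?R powr (\<alpha> - ?n)"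
          by (rule powr_mult)
        also have "(1/2 :: real) powr (\<alpha> - ?n) = 2 powr (?n - \<alpha>)"
          by (simp add: powr_divide powr_minus_divide[symmetric])
        finally show ?thesis
          using R powr_add[of ?R "\<alpha> - ?n" ?n] by (simp add: powr_realpow)
      qed
      also have "?R powr \<alpha> = r powr \<alpha> * q ^ k"
        using r by (simp add: powr_mult q_def powr_powr powr_realpow[symmetric] mult.commute)
      finally show "(\<integral>\<^sup>+y. ennreal (a k) * indicator (ball x ?R) y \<partial>lborel)
          = ennreal (2 powr (?n - \<alpha>) * \<omega> * r powr \<alpha> * q ^ k)" by (simp add: mult_ac)
    qed
    also have "\<dots> = ennreal (2 powr (?n - \<alpha>) * \<omega> * r powr \<alpha> * (1 / (1 - q)))"
      using q \<omega> by (intro suminf_ennreal_eq sums_mult geometric_sums) auto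
    finally show ?thesis by (simp add: C_def mult_ac)
  qed
  moreover have "0 < C" using q \<omega> by (simp add: C_def)
  ultimately show ?thesis using that by blast
qed

text \<open>
  Uniform absolute continuity of the potentials: near the pole the ball estimate applies, away from it
  the kernel is bounded.
\<close>

lemma nn_integral_riesz_kernel_small_set:
  assumes "0 < \<alpha>" and "\<alpha> < real CARD('n::finite)" and "0 < \<epsilon>"
  obtains \<delta> where "0 < \<delta>"
    and "\<And>(A :: (real ^ 'n) set) x. A \<in> sets borel \<Longrightarrow> emeasure lborel A \<le> ennreal \<delta> \<Longrightarrow>
           (\<integral>\<^sup>+y. ennreal (riesz_kernel \<alpha> x y) * indicator A y \<partial>lborel) \<le> ennreal \<epsilon>"
proof -
  obtain C where C: "0 < C" and ball: "\<And>(x :: real ^ 'n) r. 0 < r \<Longrightarrow>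
      (\<integral>\<^sup>+y. ennreal (riesz_kernel \<alpha> x y) * indicator (ball x r) y \<partial>lborel) \<le> ennreal (C * r powr \<alpha>)"
    using nn_integral_riesz_kernel_ball[OF assms(1,2)] by blast
  \<comment> \<open>Solve \<open>C * r powr \<alpha> = \<epsilon> / 2\<close>.\<close>
  define r where "r = (\<epsilon> / (2 * C)) powr (1 / \<alpha>)"
  have r: "0 < r" "C * r powr \<alpha> = \<epsilon> / 2"
    using C assms by (auto simp: r_def powr_powr)
  let ?b = "r powr (\<alpha> - real CARD('n))"
  define \<delta> where "\<delta> = \<epsilon> / (2 * ?b)"
  show ?thesis
  proof
    show "0 < \<delta>" using r assms by (simp add: \<delta>_def)
  next
    fix A :: "(real ^ 'n) set" and x
    assume A [measurable]: "A \<in> sets borel" and small: "emeasure lborel A \<le> ennreal \<delta>"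
    have "(\<integral>\<^sup>+y. ennreal (riesz_kernel \<alpha> x y) * indicator A y \<partial>lborel)
        \<le> (\<integral>\<^sup>+y. ennreal (riesz_kernel \<alpha> x y) * indicator (ball x r) y + ennreal ?b * indicator A y \<partial>lborel)"
    proof (rule nn_integral_mono)
      fix y
      show "ennreal (riesz_kernel \<alpha> x y) * indicator A y
          \<le> ennreal (riesz_kernel \<alpha> x y) * indicator (ball x r) y + ennreal ?b * indicator A y"
        using riesz_kernel_antimono[OF assms(2) r(1), of x y]
        by (cases "y \<in> ball x r") (auto simp: indicator_def dist_norm ennreal_leI)
    qed
    also have "\<dots> = (\<integral>\<^sup>+y. ennreal (riesz_kernel \<alpha> x y) * indicator (ball x r) y \<partial>lborel) + ennreal ?b * emeasure lborel A"
      by (subst nn_integral_add) (measurable, auto simp: nn_integral_cmult_indicator)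
    also have "\<dots> \<le> ennreal (\<epsilon> / 2) + ennreal ?b * ennreal \<delta>"
      using ball[OF r(1), of x] small r by (intro add_mono mult_left_mono) auto
    also have "\<dots> = ennreal (\<epsilon> / 2 + ?b * \<delta>)"
      using r assms by (simp add: ennreal_mult[symmetric] \<delta>_def ennreal_plus[symmetric] del: ennreal_plus)
    also have "\<epsilon> / 2 + ?b * \<delta> = \<epsilon>" using r by (simp add: \<delta>_def)
    finally show "(\<integral>\<^sup>+y. ennreal (riesz_kernel \<alpha> x y) * indicator A y \<partial>lborel) \<le> ennreal \<epsilon>" .
  qed
qed

section \<open>Continuity of solutions\<close>

lemma regular_positive_solution_locally_bounded:
  fixes u :: "real ^ 'n::finite \<Rightarrow> real"
  assumes "regular_positive_solution \<alpha> p u"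
  obtains r B where "0 < r" and "\<And>y. y \<in> ball x r \<Longrightarrow> u y \<le> B"
proof -
  obtain U where U: "open U" "x \<in> U" "bounded (u ` U)"
    using assms unfolding regular_positive_solution_def singularity_def by blast
  obtain r where r: "0 < r" "ball x r \<subseteq> U"
    using U openE by blast
  obtain B where B: "\<And>y. y \<in> U \<Longrightarrow> norm (u y) \<le> B"
    using U(3) by (auto simp: bounded_iff)
  show ?thesis
  proof (rule that[OF r(1)])
    fix y assume "y \<in> ball x r"
    then have "norm (u y) \<le> B" using B r by blast
    then show "u y \<le> B" by simp
  qed
qed

text \<open>
  The part of a potential coming from outside a ball is continuous at the centre, by dominated
  convergence: for \<open>w\<close> in the ball of half the radius the kernel at \<open>w\<close> is at most \<open>2^(n - \<alpha>)\<close> times the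
  kernel at the centre.
\<close>

lemma tendsto_riesz_potential_off_ball:
  fixes f :: "real ^ 'n::finite \<Rightarrow> real"
  assumes \<alpha>: "\<alpha> < real CARD('n)" and r: "0 < r"
    and f [measurable]: "f \<in> borel_measurable lebesgue"
    and int: "integrable lebesgue (\<lambda>y. riesz_kernel \<alpha> x y * f y)"
  shows "((\<lambda>w. \<integral>y. indicator (- ball x r) y * (riesz_kernel \<alpha> w y * f y) \<partial>lebesgue)
           \<longlongrightarrow> (\<integral>y. indicator (- ball x r) y * (riesz_kernel \<alpha> x y * f y) \<partial>lebesgue)) (at x)"
    (is "(?g \<longlongrightarrow> ?g x) (at x)")
proof -
  have [measurable]: "(\<lambda>y :: real ^ 'n. y) \<in> borel_measurable lebesgue"
    using id_borel_measurable_lebesgue by (simp add: id_def)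
  have "continuous (at x within ball x (r/2)) ?g"
    unfolding continuous_within_sequentially
  proof (intro allI impI, elim conjE)
    fix X :: "nat \<Rightarrow> real ^ 'n"
    assume X: "\<forall>n. X n \<in> ball x (r/2)" and lim: "X \<longlonglongrightarrow> x"
    let ?c = "2 powr (real CARD('n) - \<alpha>)"
    have bound: "riesz_kernel \<alpha> (X n) y \<le> ?c * riesz_kernel \<alpha> x y" if "y \<notin> ball x r" for n y
    proof -
      have "norm (x - y) / 2 \<le> norm (X n - y)" and pos: "0 < norm (x - y)"
        using X[rule_format, of n] that r norm_triangle_ineq[of "x - X n" "X n - y"]
        by (auto simp: dist_norm)
      then have "riesz_kernel \<alpha> (X n) y \<le> (norm (x - y) / 2) powr (\<alpha> - real CARD('n))"
        by (intro riesz_kernel_antimono \<alpha>) auto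
      also have "\<dots> = ?c * riesz_kernel \<alpha> x y"
        using pos powr_minus_divide[of "norm (x - y)" "real CARD('n) - \<alpha>"] powr_minus_divide[of 2 "real CARD('n) - \<alpha>"]
        by (simp add: powr_divide riesz_kernel_def)
      finally show ?thesis .
    qed
    have "(\<lambda>n. ?g (X n)) \<longlonglongrightarrow> ?g x"
    proof (rule integral_dominated_convergence[where w = "\<lambda>y. ?c * \<bar>riesz_kernel \<alpha> x y * f y\<bar>"])
      show "integrable lebesgue (\<lambda>y. ?c * \<bar>riesz_kernel \<alpha> x y * f y\<bar>)"
        using int by auto
      show "AE y in lebesgue. (\<lambda>n. indicator (- ball x r) y * (riesz_kernel \<alpha> (X n) y * f y))
               \<longlonglongrightarrow> indicator (- ball x r) y * (riesz_kernel \<alpha> x y * f y)"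
      proof (intro AE_I2)
        fix y
        show "(\<lambda>n. indicator (- ball x r) y * (riesz_kernel \<alpha> (X n) y * f y))
               \<longlonglongrightarrow> indicator (- ball x r) y * (riesz_kernel \<alpha> x y * f y)"
        proof (cases "y \<in> ball x r")
          case False
          with r have "norm (x - y) \<noteq> 0" by auto
          then show ?thesis
            unfolding riesz_kernel_def by (intro tendsto_intros lim) auto
        qed simp
      qed
      show "AE y in lebesgue. norm (indicator (- ball x r) y * (riesz_kernel \<alpha> (X n) y * f y))
               \<le> ?c * \<bar>riesz_kernel \<alpha> x y * f y\<bar>" for n
      proof (intro AE_I2)
        fix y
        show "norm (indicator (- ball x r) y * (riesz_kernel \<alpha> (X n) y * f y))
               \<le> ?c * \<bar>riesz_kernel \<alpha> x y * f y\<bar>"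
          using mult_right_mono[OF bound[of y n], of "\<bar>f y\<bar>"]
          by (cases "y \<in> ball x r") (auto simp: abs_mult riesz_kernel_nonneg mult.assoc)
      qed
    qed measurable
    then show "(?g \<circ> X) \<longlonglongrightarrow> ?g x" by (simp add: o_def)
  qed
  then show ?thesis
    using r by (simp add: continuous_within at_within_open[of x "ball x (r/2)"])
qed

text \<open>
  Near a point \<open>u ^ p\<close> is bounded (here \<open>p > 0\<close> turns an upper bound for \<open>u\<close> into one for
  \<open>u ^ p\<close>), so a small ball contributes uniformly little to the potential at its points, and the
  rest of the potential is continuous at the centre.
\<close>

lemma continuous_on_regular_positive_solution:
  fixes u :: "real ^ 'n::finite \<Rightarrow> real"
  assumes \<alpha>: "0 < \<alpha>" "\<alpha> < real CARD('n)" and p: "0 < p"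
    and u: "regular_positive_solution \<alpha> p u"
  shows "continuous_on UNIV u"
proof -
  have "(u \<longlongrightarrow> u x) (at x)" for x
  proof (rule tendstoI)
    fix e :: real assume e: "0 < e"
    have [measurable]: "u \<in> borel_measurable lebesgue" and pos: "\<And>y. 0 < u y"
      and eq: "\<And>w. has_bochner_integral lebesgue (\<lambda>y. riesz_kernel \<alpha> w y * u y powr p) (u w)"
      using u by (auto simp: regular_positive_solution_def)
    obtain r\<^sub>0 B where r\<^sub>0: "0 < r\<^sub>0" and B: "\<And>y. y \<in> ball x r\<^sub>0 \<Longrightarrow> u y \<le> B"
      using regular_positive_solution_locally_bounded[OF u] by blast
    define K where "K = B powr p"
    have K: "u y powr p \<le> K" if "y \<in> ball x r\<^sub>0" for y
      unfolding K_def using B[OF that] pos[of y] p by (intro powr_mono2) auto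
    have K0: "0 < K"
      using B[of x] pos[of x] r\<^sub>0 by (simp add: K_def)
    obtain C where C: "0 < C" and ball: "\<And>(x :: real ^ 'n) r. 0 < r \<Longrightarrow>
        (\<integral>\<^sup>+y. ennreal (riesz_kernel \<alpha> x y) * indicator (ball x r) y \<partial>lborel) \<le> ennreal (C * r powr \<alpha>)"
      using nn_integral_riesz_kernel_ball[OF \<alpha>] by blast
    \<comment> \<open>The ball of radius \<open>\<rho>\<close> around any point contributes at most \<open>e / 3\<close>; it contains the ball of radius \<open>r\<close>
      around \<open>x\<close> as soon as its centre is in the latter.\<close>
    define \<rho> where "\<rho> = (e / (3 * K * C)) powr (1 / \<alpha>)"
    have \<rho>: "0 < \<rho>" "K * (C * \<rho> powr \<alpha>) = e / 3"
      using C K0 e \<alpha> by (auto simp: \<rho>_def powr_powr)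
    define r where "r = min r\<^sub>0 (\<rho> / 2)"
    have r: "0 < r" "r \<le> r\<^sub>0" "2 * r \<le> \<rho>"
      using r\<^sub>0 \<rho> by (auto simp: r_def)
    let ?g = "\<lambda>w. \<integral>y. indicator (- ball x r) y * (riesz_kernel \<alpha> w y * u y powr p) \<partial>lebesgue"
    have near: "0 \<le> u w - ?g w \<and> u w - ?g w \<le> e / 3" if w: "w \<in> ball x r" for w
    proof -
      let ?k = "\<lambda>y. riesz_kernel \<alpha> w y * u y powr p"
      have int: "integrable lebesgue ?k" and uw: "u w = integral\<^sup>L lebesgue ?k"
        using eq[of w] by (auto simp: has_bochner_integral_iff)
      have i1: "integrable lebesgue (\<lambda>y. indicator (- ball x r) y * ?k y)"
       and i2: "integrable lebesgue (\<lambda>y. indicator (ball x r) y * ?k y)"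
        using integrable_mult_indicator[OF _ int, of "- ball x r"] integrable_mult_indicator[OF _ int, of "ball x r"]
        by auto
      have "u w - ?g w = (\<integral>y. ?k y - indicator (- ball x r) y * ?k y \<partial>lebesgue)"
        using i1 int uw by simp
      also have "\<dots> = (\<integral>y. indicator (ball x r) y * ?k y \<partial>lebesgue)"
        by (intro Bochner_Integration.integral_cong) (auto simp: indicator_def)
      finally have *: "u w - ?g w = (\<integral>y. indicator (ball x r) y * ?k y \<partial>lebesgue)" .
      have "ennreal (u w - ?g w) = (\<integral>\<^sup>+y. ennreal (indicator (ball x r) y * ?k y) \<partial>lebesgue)"
        unfolding * by (rule nn_integral_eq_integral[symmetric, OF i2]) (auto simp: riesz_kernel_nonneg)
      also have "\<dots> \<le> (\<integral>\<^sup>+y. ennreal K * (ennreal (riesz_kernel \<alpha> w y) * indicator (ball w \<rho>) y) \<partial>lebesgue)"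
      proof (intro nn_integral_mono)
        fix y
        show "ennreal (indicator (ball x r) y * ?k y) \<le> ennreal K * (ennreal (riesz_kernel \<alpha> w y) * indicator (ball w \<rho>) y)"
        proof (cases "y \<in> ball x r")
          case True
          then have "dist w y < 2 * r"
            using w dist_triangle_less_add[of w x r y r] by (simp add: dist_commute)
          then have "y \<in> ball w \<rho>" using r by simp
          moreover have "?k y \<le> K * riesz_kernel \<alpha> w y"
            using mult_left_mono[OF K riesz_kernel_nonneg, of y \<alpha> w] True r by (simp add: mult.commute)
          ultimately show ?thesis
            using True K0 by (simp add: ennreal_mult[symmetric] riesz_kernel_nonneg ennreal_leI)
        qed simp
      qed
      also have "\<dots> = ennreal K * (\<integral>\<^sup>+y. (ennreal (riesz_kernel \<alpha> w y) * indicator (ball w \<rho>) y) \<partial>lborel)"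
        unfolding nn_integral_completion by (rule nn_integral_cmult) measurable
      also have "\<dots> \<le> ennreal K * ennreal (C * \<rho> powr \<alpha>)"
        by (intro mult_left_mono ball \<rho>) auto
      also have "\<dots> = ennreal (e / 3)"
        unfolding \<rho>(2)[symmetric] using K0 C by (simp add: ennreal_mult)
      finally have "u w - ?g w \<le> e / 3" using e by simp
      moreover have "0 \<le> u w - ?g w"
        unfolding * by (intro Bochner_Integration.integral_nonneg) (auto simp: riesz_kernel_nonneg)
      ultimately show ?thesis by simp
    qed
    have "(?g \<longlongrightarrow> ?g x) (at x)"
      using eq[of x] r by (intro tendsto_riesz_potential_off_ball \<alpha>) (auto simp: has_bochner_integral_iff)
    then have "eventually (\<lambda>w. dist (?g w) (?g x) < e / 3) (at x)"
      using e by (intro tendstoD) auto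
    moreover have "eventually (\<lambda>w. w \<in> ball x r) (at x)"
      using eventually_at_ball[OF r(1), of x UNIV] by simp
    ultimately show "eventually (\<lambda>w. dist (u w) (u x) < e) (at x)"
    proof eventually_elim
      case (elim w)
      then have "\<bar>?g w - ?g x\<bar> < e / 3" "0 \<le> u w - ?g w" "u w - ?g w \<le> e / 3"
          "0 \<le> u x - ?g x" "u x - ?g x \<le> e / 3"
        using near[of w] near[of x] r by (auto simp: dist_real_def)
      then show ?case using e unfolding dist_real_def abs_if by (simp split: if_splits)
    qed
  qed
  then show ?thesis
    by (simp add: continuous_on_def)
qed

section \<open>Inequalities for powers and for the inverted kernel\<close>

text \<open>
  One linear bound that serves both concave and convex powers: the factor \<open>w powr (p - 1)\<close> is taken at
  the larger argument also for \<open>p < 1\<close>, where it is the smaller derivative, which still suffices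
  since \<open>t \<le> t powr p\<close> for \<open>0 \<le> t \<le> 1\<close>.
\<close>

lemma powr_diff_le:
  fixes v w p :: real
  assumes "0 < v" "v \<le> w" "0 < p"
  shows "w powr p - v powr p \<le> max 1 p * w powr (p - 1) * (w - v)"
proof (cases "p \<le> 1")
  case True
  have w: "0 < w" using assms by simp
  have "(v / w) powr 1 \<le> (v / w) powr p"
    using True assms by (intro powr_mono') auto
  then have "w powr p * (1 - (v / w) powr p) \<le> w powr p * (1 - v / w)"
    using assms by (intro mult_left_mono) auto
  moreover have "w powr p * (v / w) powr p = v powr p"
    using w by (simp add: powr_mult[symmetric])
  moreover have "w powr p * (1 - v / w) = w powr (p - 1) * (w - v)"
    using w powr_add[of w "p - 1" 1] by (simp add: field_simps)
  ultimately show ?thesis using True by (simp add: algebra_simps)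
next
  case False
  show ?thesis
  proof (cases "v = w")
    case neq: False
    then have "v < w" using assms by simp
    then obtain x where x: "v < x" "x < w"
      and eq: "w powr p - v powr p = (w - v) * (p * x powr (p - 1))"
      using MVT2[of v w "\<lambda>x. x powr p" "\<lambda>x. p * x powr (p - 1)"] assms
      by (force intro!: derivative_eq_intros)
    have "(w - v) * (p * x powr (p - 1)) \<le> (w - v) * (p * w powr (p - 1))"
      using x False assms by (intro mult_left_mono powr_mono2) auto
    with eq False show ?thesis by (simp add: mult_ac)
  qed simp
qed

lemma norm_inversion_diff:
  fixes x z :: "'a::real_inner"
  assumes "x \<noteq> 0" "z \<noteq> 0" 
  shows "norm (inversion r x - inversion r z) = r\<^sup>2 * norm (x - z) / (norm x * norm z)"
proof (rule power2_eq_imp_eq)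
  show "(norm (inversion r x - inversion r z))\<^sup>2 = (r\<^sup>2 * norm (x - z) / (norm x * norm z))\<^sup>2"
    using assms
    by (simp add: inversion_def power2_norm_eq_inner power_mult_distrib power_divide inner_diff inner_commute)
       (simp add: field_simps power2_eq_square)
qed (use assms in auto)

text \<open>
  The last term, positive when \<open>x\<close> and \<open>z\<close> lie inside the sphere, is the reason why the kernel in
  \<open>kelvin_difference\<close> is positive; the symmetry of the right-hand side in \<open>x\<close> and \<open>z\<close> gives
  \<open>norm_diff_inversion_commute\<close>.
\<close>

lemma norm_diff_inversion_square:
  fixes x z :: "'a::real_inner"
  assumes "z \<noteq> 0"
  shows "(norm z * norm (x - inversion r z))\<^sup>2
           = (r * norm (x - z))\<^sup>2 + (r\<^sup>2 - (norm x)\<^sup>2) * (r\<^sup>2 - (norm z)\<^sup>2)"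
  using assms
  by (simp add: inversion_def power2_norm_eq_inner power_mult_distrib power_divide inner_diff inner_commute)
     (simp add: field_simps power2_eq_square power4_eq_xxxx)

lemma norm_diff_inversion_commute:
  fixes x z :: "'a::real_inner"
  assumes "x \<noteq> 0" "z \<noteq> 0"
  shows "norm z * norm (x - inversion r z) = norm x * norm (inversion r x - z)"
proof (rule power2_eq_imp_eq)
  show "(norm z * norm (x - inversion r z))\<^sup>2 = (norm x * norm (inversion r x - z))\<^sup>2"
    using assms norm_diff_inversion_square[of z x r] norm_diff_inversion_square[of x z r]
    by (simp add: norm_minus_commute mult.commute)
qed auto

lemma riesz_kernel_inversion_both:
  fixes x z :: "real ^ 'n::finite"
  assumes "0 < r" "x \<noteq> 0" "z \<noteq> 0"
  shows "(r / norm x) powr (real CARD('n) - \<alpha>) * (r / norm z) powr (real CARD('n) - \<alpha>)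
           * riesz_kernel \<alpha> (inversion r x) (inversion r z) = riesz_kernel \<alpha> x z"
proof -
  have "norm (inversion r x - inversion r z) = (r / norm x) * (r / norm z) * norm (x - z)"
    using assms by (simp add: norm_inversion_diff power2_eq_square)
  then show ?thesis
    using assms by (simp add: riesz_kernel_def powr_mult powr_divide)
qed

lemma riesz_kernel_inversion_commute:
  fixes x z :: "real ^ 'n::finite"
  assumes "0 < r" "x \<noteq> 0" "z \<noteq> 0"
  shows "(r / norm z) powr (real CARD('n) - \<alpha>) * riesz_kernel \<alpha> x (inversion r z)
           = (r / norm x) powr (real CARD('n) - \<alpha>) * riesz_kernel \<alpha> (inversion r x) z"
proof -
  let ?s = "real CARD('n) - \<alpha>"
  have "norm z powr ?s * norm (x - inversion r z) powr ?s = norm x powr ?s * norm (inversion r x - z) powr ?s"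
    using norm_diff_inversion_commute[OF assms(2,3), of r] by (simp add: powr_mult[symmetric])
  then show ?thesis
    using assms by (simp add: riesz_kernel_def powr_divide)
qed

lemma riesz_kernel_inversion_less:
  fixes x z :: "real ^ 'n::finite"
  assumes "\<alpha> < real CARD('n)" "z \<noteq> 0" "x \<noteq> z" "norm x < r" "norm z < r"
  shows "(r / norm z) powr (real CARD('n) - \<alpha>) * riesz_kernel \<alpha> x (inversion r z) < riesz_kernel \<alpha> x z"
proof -
  let ?s = "real CARD('n) - \<alpha>"
  have r: "0 < r" using assms(4) norm_ge_zero[of x] by linarith
  have "0 < (r\<^sup>2 - (norm x)\<^sup>2) * (r\<^sup>2 - (norm z)\<^sup>2)"
    using assms by (intro mult_pos_pos) (auto simp: power_strict_mono)
  then have "(r * norm (x - z))\<^sup>2 < (norm z * norm (x - inversion r z))\<^sup>2"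
    by (subst norm_diff_inversion_square[OF assms(2)]) simp
  then have "r * norm (x - z) < norm z * norm (x - inversion r z)"
    by (rule power2_less_imp_less) simp
  then have less: "norm (x - z) < norm z / r * norm (x - inversion r z)"
    using r by (simp add: field_simps)
  have "(r / norm z) powr ?s * riesz_kernel \<alpha> x (inversion r z)
      = 1 / (norm z / r * norm (x - inversion r z)) powr ?s"
    using r assms by (simp add: riesz_kernel_def powr_mult powr_divide)
  also have "\<dots> < 1 / norm (x - z) powr ?s"
    using less assms by (intro divide_strict_left_mono mult_pos_pos powr_less_mono2) auto
  finally show ?thesis by (simp add: riesz_kernel_def)
qed

section \<open>Comparison with the Kelvin transform\<close>

definition kelvin_transform :: "real \<Rightarrow> real \<Rightarrow> (real ^ 'n \<Rightarrow> real) \<Rightarrow> real ^ 'n \<Rightarrow> real"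
  where "kelvin_transform \<alpha> r u x = (r / norm x) powr (real CARD('n) - \<alpha>) * u (inversion r x)"

lemma AE_lborel_not_sphere: "AE y in lborel. y \<notin> sphere (a :: 'a::euclidean_space) r"
proof -
  have "sphere a r \<in> null_sets lebesgue"
    using negligible_sphere negligible_iff_null_sets by blast
  then have "emeasure lborel (sphere a r) = 0"
    by (simp add: null_sets_def)
  then show ?thesis
    by (intro AE_not_in) (simp add: null_sets_def)
qed

text \<open>
  What the comparison argument uses of a solution with positive exponent. Since \<open>u\<close> is continuous, all
  integrands are Borel functions, and the properties pass to translates of \<open>u\<close>, which moves the centre of
  the spheres.
\<close>
locale subcritical_solution =
  fixes \<alpha> p :: real and u :: "real ^ 'n::finite \<Rightarrow> real"
  assumes \<alpha>_pos: "0 < \<alpha>" and \<alpha>_less: "\<alpha> < real CARD('n)"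
    and p_pos: "0 < p" and subcritical: "p < (real CARD('n) + \<alpha>) / (real CARD('n) - \<alpha>)"
    and continuous: "continuous_on UNIV u"
    and positive: "0 < u x"
    and equation: "has_bochner_integral lborel (\<lambda>y. riesz_kernel \<alpha> x y * u y powr p) (u x)"
begin

abbreviation kelvin :: "real \<Rightarrow> real ^ 'n \<Rightarrow> real"
  where "kelvin r \<equiv> kelvin_transform \<alpha> r u"

lemma u_measurable [measurable]: "u \<in> borel_measurable borel"
  by (rule borel_measurable_continuous_onI[OF continuous])

lemma kelvin_measurable [measurable]: "kelvin r \<in> borel_measurable borel"
  unfolding kelvin_transform_def[abs_def] by measurable

lemma kelvin_pos: "0 < r \<Longrightarrow> x \<noteq> 0 \<Longrightarrow> 0 < kelvin r x"
  by (simp add: kelvin_transform_def positive)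

text \<open>
  The exterior part of the integral is pulled back by inversion; the sphere itself and the
  origin are null sets.
\<close>

lemma potential_folded_into_ball:
  assumes r: "0 < r"
  shows "has_bochner_integral lborel
    (\<lambda>z. indicator (ball 0 r - {0}) z * (riesz_kernel \<alpha> x z * u z powr p
       + (r / norm z) ^ (2 * CARD('n)) * (riesz_kernel \<alpha> x (inversion r z) * u (inversion r z) powr p)))
    (u x)"
proof -
  let ?f = "\<lambda>y. riesz_kernel \<alpha> x y * u y powr p"
  have f: "integrable lborel ?f" "u x = integral\<^sup>L lborel ?f"
    using equation[of x] by (auto simp: has_bochner_integral_iff)
  have 1: "integrable lborel (\<lambda>y. indicator (ball 0 r - {0}) y * ?f y)"
    using integrable_mult_indicator[OF _ f(1), of "ball 0 r - {0}"] by simp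
  have 2: "integrable lborel (\<lambda>y. indicator (- cball 0 r) y * ?f y)"
    using integrable_mult_indicator[OF _ f(1), of "- cball 0 r"] by simp
  have "u x = (\<integral>y. indicator (ball 0 r - {0}) y * ?f y + indicator (- cball 0 r) y * ?f y \<partial>lborel)"
    unfolding f(2)
  proof (rule integral_cong_AE)
    have "AE y in lborel. y \<notin> sphere 0 r \<and> y \<noteq> (0 :: real ^ 'n)"
      using AE_lborel_not_sphere[of "0 :: real ^ 'n" r] AE_lborel_singleton[of "0 :: real ^ 'n"] by auto
    then show "AE y in lborel. ?f y = indicator (ball 0 r - {0}) y * ?f y + indicator (- cball 0 r) y * ?f y"
      by eventually_elim (auto simp: indicator_def)
  qed (use f(1) 1 2 in auto)
  also have "\<dots> = (\<integral>y. indicator (ball 0 r - {0}) y * ?f y \<partial>lborel) + (\<integral>y. indicator (- cball 0 r) y * ?f y \<partial>lborel)"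
    using 1 2 by simp
  finally show ?thesis
    using has_bochner_integral_add[OF has_bochner_integral_integrable[OF 1] has_bochner_integral_inversion[OF r f(1)]]
    by (simp add: distrib_left)
qed

text \<open>
  Fold the potentials at \<open>x\<close> and at \<open>inversion r x\<close> into the ball and subtract. By the
  inversion identities for the kernel the two coefficients of \<open>u z powr p\<close> and the two coefficients of
  \<open>u (inversion r z) powr p\<close> match up to the sign and the factor \<open>(r / norm z) powr (n + \<alpha>)\<close>. The point
  \<open>z = x\<close> is removed because the kernel has the value \<open>0\<close> there, which would spoil its positivity.
\<close>

lemma kelvin_difference:
  assumes r: "0 < r" and x: "x \<noteq> 0"
  shows "has_bochner_integral lborel
    (\<lambda>z. indicator (ball 0 r - {0, x}) z
       * ((riesz_kernel \<alpha> x z - (r / norm z) powr (real CARD('n) - \<alpha>) * riesz_kernel \<alpha> x (inversion r z))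
        * (u z powr p - (r / norm z) powr (real CARD('n) + \<alpha>) * u (inversion r z) powr p)))
    (u x - kelvin r x)"
proof -
  let ?n = "real CARD('n)"
  let ?F = "\<lambda>x z. indicator (ball 0 r - {0}) z * (riesz_kernel \<alpha> x z * u z powr p
       + (r / norm z) ^ (2 * CARD('n)) * (riesz_kernel \<alpha> x (inversion r z) * u (inversion r z) powr p))"
  let ?G = "\<lambda>z. (riesz_kernel \<alpha> x z - (r / norm z) powr (?n - \<alpha>) * riesz_kernel \<alpha> x (inversion r z))
        * (u z powr p - (r / norm z) powr (?n + \<alpha>) * u (inversion r z) powr p)"
  have "has_bochner_integral lborel (\<lambda>z. ?F x z - (r / norm x) powr (?n - \<alpha>) * ?F (inversion r x) z)
      (u x - (r / norm x) powr (?n - \<alpha>) * u (inversion r x))"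
    by (intro has_bochner_integral_diff has_bochner_integral_mult_right potential_folded_into_ball r)
  also have "(\<lambda>z. ?F x z - (r / norm x) powr (?n - \<alpha>) * ?F (inversion r x) z) = (\<lambda>z. indicator (ball 0 r - {0}) z * ?G z)"
  proof
    fix z
    show "?F x z - (r / norm x) powr (?n - \<alpha>) * ?F (inversion r x) z = indicator (ball 0 r - {0}) z * ?G z"
    proof (cases "z \<in> ball 0 r - {0}")
      case True
      then have z: "z \<noteq> 0" by simp
      \<comment> \<open>Split the Jacobian: one factor is absorbed by the kernel, the other remains with the source term.\<close>
      have 2: "(r / norm z) ^ (2 * CARD('n)) = (r / norm z) powr (?n - \<alpha>) * (r / norm z) powr (?n + \<alpha>)"
        using r z powr_realpow[of "r / norm z" "2 * CARD('n)"] by (simp add: powr_add[symmetric])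
      define a where "a = (r / norm z) powr (?n - \<alpha>)"
      define b where "b = (r / norm z) powr (?n + \<alpha>)"
      define c where "c = (r / norm x) powr (?n - \<alpha>)"
      have k1: "c * a * riesz_kernel \<alpha> (inversion r x) (inversion r z) = riesz_kernel \<alpha> x z"
        unfolding a_def c_def by (rule riesz_kernel_inversion_both[OF r x z])
      have k2: "c * riesz_kernel \<alpha> (inversion r x) z = a * riesz_kernel \<alpha> x (inversion r z)"
        unfolding a_def c_def by (rule riesz_kernel_inversion_commute[OF r x z, symmetric])
      have "?F x z - c * ?F (inversion r x) z
         = riesz_kernel \<alpha> x z * u z powr p + a * b * riesz_kernel \<alpha> x (inversion r z) * u (inversion r z) powr p
         - (c * riesz_kernel \<alpha> (inversion r x) z) * u z powr p
         - b * (c * a * riesz_kernel \<alpha> (inversion r x) (inversion r z)) * u (inversion r z) powr p"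
        unfolding 2 a_def[symmetric] b_def[symmetric] using True by (simp add: algebra_simps)
      also have "\<dots> = ?G z"
        unfolding k1 k2 a_def[symmetric] b_def[symmetric] by (simp add: algebra_simps)
      finally show ?thesis using True by (simp add: c_def)
    qed simp
  qed
  finally have *: "has_bochner_integral lborel (\<lambda>z. indicator (ball 0 r - {0}) z * ?G z) (u x - kelvin r x)"
    by (simp add: kelvin_transform_def)
  define G where "G = ?G"
  have [measurable]: "G \<in> borel_measurable borel" "ball 0 r - {0, x} \<in> sets borel"
    unfolding G_def by (measurable, auto)
  have ae: "AE z in lborel. indicator (ball 0 r - {0}) z * G z = indicator (ball 0 r - {0, x}) z * G z"
    using AE_lborel_singleton[of x] by eventually_elim (auto simp: indicator_def)
  have m: "(\<lambda>z. indicator (ball 0 r - {0, x}) z * G z) \<in> borel_measurable lborel"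
    by measurable
  have G: "has_bochner_integral lborel (\<lambda>z. indicator (ball 0 r - {0}) z * G z) (u x - kelvin r x)"
    using * by (simp only: G_def)
  have "has_bochner_integral lborel (\<lambda>z. indicator (ball 0 r - {0, x}) z * G z) (u x - kelvin r x)"
    using G has_bochner_integral_cong_AE[OF borel_measurable_has_bochner_integral[OF G] m ae] by (rule iffD1[rotated])
  then show ?thesis by (simp only: G_def)
qed

text \<open>
  The point where subcriticality enters: the exponent \<open>n + \<alpha>\<close> exceeds the exponent \<open>p (n - \<alpha>)\<close> that
  would make the equation conformally invariant, and \<open>r / norm z > 1\<close> inside the sphere.
\<close>

lemma kelvin_powr_less:
  assumes "z \<noteq> 0" "norm z < r"
  shows "kelvin r z powr p < (r / norm z) powr (real CARD('n) + \<alpha>) * u (inversion r z) powr p"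
proof -
  have "p * (real CARD('n) - \<alpha>) < real CARD('n) + \<alpha>"
    using subcritical \<alpha>_less by (simp add: field_simps)
  moreover have "1 < r / norm z" using assms by simp
  ultimately have "(r / norm z) powr ((real CARD('n) - \<alpha>) * p) < (r / norm z) powr (real CARD('n) + \<alpha>)"
    by (intro powr_less_mono) (auto simp: mult.commute)
  then show ?thesis
    using positive[of "inversion r z"] by (simp add: kelvin_transform_def powr_mult powr_powr)
qed

text \<open>
  A strong maximum principle: under the weak comparison the integrand in \<open>kelvin_difference\<close> is
  negative at every point of a nonempty open set.
\<close>

lemma kelvin_comparison_strict:
  assumes le: "\<And>z. z \<noteq> 0 \<Longrightarrow> norm z < r \<Longrightarrow> u z \<le> kelvin r z"
    and x: "x \<noteq> 0" "norm x < r"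
  shows "u x < kelvin r x"
proof -
  have r: "0 < r" using x norm_ge_zero[of x] by linarith
  let ?D = "ball 0 r - {0, x}"
  define G where "G z = (riesz_kernel \<alpha> x z - (r / norm z) powr (real CARD('n) - \<alpha>) * riesz_kernel \<alpha> x (inversion r z))
        * (u z powr p - (r / norm z) powr (real CARD('n) + \<alpha>) * u (inversion r z) powr p)" for z
  have neg: "G z < 0" if "z \<in> ?D" for z
    unfolding G_def
  proof (rule mult_pos_neg)
    show "0 < riesz_kernel \<alpha> x z - (r / norm z) powr (real CARD('n) - \<alpha>) * riesz_kernel \<alpha> x (inversion r z)"
      using riesz_kernel_inversion_less[of \<alpha> z x r] that x \<alpha>_less by auto
    have "u z powr p \<le> kelvin r z powr p"
      using that le p_pos positive[of z] by (intro powr_mono2) (auto simp: less_imp_le)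
    then show "u z powr p - (r / norm z) powr (real CARD('n) + \<alpha>) * u (inversion r z) powr p < 0"
      using kelvin_powr_less[of z r] that by auto
  qed
  have int: "has_bochner_integral lborel (\<lambda>z. indicator ?D z * G z) (u x - kelvin r x)"
    unfolding G_def by (rule kelvin_difference[OF r x(1)])
  have "open ?D" by (intro open_Diff) auto
  have "infinite (ball (0 :: real ^ 'n) r)"
    using finite_imp_not_open[of "ball (0 :: real ^ 'n) r"] r by auto
  then obtain w where w: "w \<in> ?D"
    by (metis Diff_eq_empty_iff equals0I finite.emptyI finite.insertI finite_subset)
  have nonneg: "0 \<le> - (indicator ?D z * G z)" for z
    using neg[of z] by (cases "z \<in> ?D") (auto simp: less_imp_le)
  have i: "integrable lborel (\<lambda>z. - (indicator ?D z * G z))"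
    and eq: "kelvin r x - u x = (\<integral>z. - (indicator ?D z * G z) \<partial>lborel)"
    using has_bochner_integral_minus[OF int] by (auto simp: has_bochner_integral_iff)
  have "kelvin r x - u x \<noteq> 0"
  proof
    assume "kelvin r x - u x = 0"
    then have "AE z in lborel. - (indicator ?D z * G z) = 0"
      unfolding eq using integral_nonneg_eq_0_iff_AE[OF i] nonneg by simp
    then have "AE z in lborel. z \<in> - ?D"
    proof eventually_elim
      fix z assume "- (indicator ?D z * G z) = 0"
      then show "z \<in> - ?D" using neg[of z] by (cases "z \<in> ?D") auto
    qed
    then have "AE z in lebesgue. z \<in> - ?D" by (rule AE_completion)
    moreover have "closed (- ?D)"
      unfolding closed_def using \<open>open ?D\<close> by (simp only: double_complement)
    ultimately have "w \<in> - ?D"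
      by (metis mem_closed_if_AE_lebesgue)
    with w show False by blast
  qed
  moreover have "0 \<le> kelvin r x - u x"
    unfolding eq using nonneg by (rule Bochner_Integration.integral_nonneg)
  ultimately show ?thesis by simp
qed

text \<open>
  Only bad points contribute positively to \<open>kelvin_difference\<close>, and there the integrand is at most
  \<open>L M\<close> times the Riesz kernel, where \<open>M\<close> is the supremum of \<open>u - kelvin r\<close> over the bad set. When
  the potential of the bad set is at most \<open>1 / (2 L)\<close> this yields \<open>M \<le> M / 2\<close>, which is impossible
  for a positive finite \<open>M\<close>.
\<close>

lemma kelvin_comparison_small_bad_set:
  fixes r L :: real
  defines "bad \<equiv> {z. z \<noteq> 0 \<and> norm z < r \<and> kelvin r z < u z}"
  assumes L: "\<And>z. norm z < r \<Longrightarrow> max 1 p * u z powr (p - 1) \<le> L"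
    and B: "\<And>z. norm z < r \<Longrightarrow> u z \<le> B"
    and small: "\<And>x. (\<integral>\<^sup>+z. ennreal (riesz_kernel \<alpha> x z) * indicator bad z \<partial>lborel) \<le> ennreal (1 / (2 * L))"
  shows "bad = {}"
proof (rule ccontr)
  assume nonempty: "bad \<noteq> {}"
  define M where "M = (SUP z\<in>bad. u z - kelvin r z)"
  obtain z\<^sub>0 where z0: "z\<^sub>0 \<in> bad" using nonempty by blast
  then have r: "0 < r" unfolding bad_def using norm_ge_zero[of z\<^sub>0] by (blast intro: le_less_trans)
  have bdd: "bdd_above ((\<lambda>z. u z - kelvin r z) ` bad)"
  proof (rule bdd_aboveI2)
    fix z assume "z \<in> bad"
    then show "u z - kelvin r z \<le> B" using B[of z] kelvin_pos[OF r, of z] by (auto simp: bad_def)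
  qed
  have M: "u z - kelvin r z \<le> M" if "z \<in> bad" for z
    unfolding M_def using that bdd by (rule cSUP_upper)
  have M_pos: "0 < M" using M[OF z0] z0 by (auto simp: bad_def)
  have "0 < max 1 p * u z\<^sub>0 powr (p - 1)" using positive[of z\<^sub>0] by simp
  then have L_pos: "0 < L" using L[of z\<^sub>0] z0 by (auto simp: bad_def)
  have half: "u x - kelvin r x \<le> M / 2" if x: "x \<in> bad" for x
  proof -
    let ?D = "ball 0 r - {0, x}"
    let ?K = "\<lambda>z. riesz_kernel \<alpha> x z - (r / norm z) powr (real CARD('n) - \<alpha>) * riesz_kernel \<alpha> x (inversion r z)"
    let ?W = "\<lambda>z. u z powr p - (r / norm z) powr (real CARD('n) + \<alpha>) * u (inversion r z) powr p"
    have x': "x \<noteq> 0" "norm x < r" using x by (auto simp: bad_def)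
    have bound: "indicator ?D z * (?K z * ?W z) \<le> L * M * (riesz_kernel \<alpha> x z * indicator bad z)" for z
    proof (cases "z \<in> ?D")
      case True
      then have z: "z \<noteq> 0" "norm z < r" "x \<noteq> z" by auto
      have K0: "0 < ?K z"
        using riesz_kernel_inversion_less[OF \<alpha>_less z(1,3) x'(2) z(2)] by simp
      have K1: "?K z \<le> riesz_kernel \<alpha> x z" by (simp add: riesz_kernel_nonneg)
      show ?thesis
      proof (cases "z \<in> bad")
        case True
        have "?W z \<le> u z powr p - kelvin r z powr p"
          using kelvin_powr_less[OF z(1,2)] by simp
        also have "\<dots> \<le> max 1 p * u z powr (p - 1) * (u z - kelvin r z)"
          using True kelvin_pos[OF r z(1)] p_pos by (intro powr_diff_le) (auto simp: bad_def)
        also have "\<dots> \<le> L * M"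
          using L[OF z(2)] M[OF True] True L_pos by (intro mult_mono) (auto simp: bad_def)
        finally have "?K z * ?W z \<le> ?K z * (L * M)"
          using K0 by (intro mult_left_mono) auto
        also have "\<dots> \<le> riesz_kernel \<alpha> x z * (L * M)"
          using K1 L_pos M_pos by (intro mult_right_mono) auto
        finally show ?thesis using True \<open>z \<in> ?D\<close> by (simp add: mult_ac)
      next
        case False
        then have "u z powr p \<le> kelvin r z powr p"
          using z p_pos positive[of z] by (intro powr_mono2) (auto simp: bad_def less_imp_le)
        then have "?W z < 0" using kelvin_powr_less[OF z(1,2)] by simp
        then have "?K z * ?W z \<le> 0" using K0 by (simp add: mult_pos_neg less_imp_le)
        then show ?thesis using False True by simp
      qed
    next
      case False
      then show ?thesis using L_pos M_pos by (simp add: riesz_kernel_nonneg)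
    qed
    have [measurable]: "bad \<in> sets borel" unfolding bad_def by measurable
    let ?R = "\<lambda>z. L * M * (riesz_kernel \<alpha> x z * indicator bad z)"
    have "(\<integral>\<^sup>+z. ennreal (?R z) \<partial>lborel) = ennreal (L * M) * (\<integral>\<^sup>+z. ennreal (riesz_kernel \<alpha> x z) * indicator bad z \<partial>lborel)"
      using L_pos M_pos
      by (subst nn_integral_cmult[symmetric]) (measurable, auto intro!: nn_integral_cong simp: ennreal_mult riesz_kernel_nonneg indicator_def)
    also have "\<dots> \<le> ennreal (L * M) * ennreal (1 / (2 * L))"
      by (intro mult_left_mono small) auto
    also have "\<dots> = ennreal (M / 2)"
      using L_pos M_pos by (simp add: ennreal_mult[symmetric])
    finally have R: "(\<integral>\<^sup>+z. ennreal (?R z) \<partial>lborel) \<le> ennreal (M / 2)" .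
    have intR: "integrable lborel ?R"
    proof (rule integrableI_nonneg)
      show "(\<integral>\<^sup>+z. ennreal (?R z) \<partial>lborel) < \<infinity>"
        using R by (rule le_less_trans) simp
    qed (use L_pos M_pos in \<open>auto simp: riesz_kernel_nonneg\<close>)
    have "u x - kelvin r x = (\<integral>z. indicator ?D z * (?K z * ?W z) \<partial>lborel)"
      using kelvin_difference[OF r x'(1)] by (simp add: has_bochner_integral_iff)
    also have "\<dots> \<le> integral\<^sup>L lborel ?R"
      using kelvin_difference[OF r x'(1)] intR bound
      by (intro integral_mono) (auto simp: has_bochner_integral_iff)
    also have "\<dots> \<le> M / 2"
    proof -
      have "ennreal (integral\<^sup>L lborel ?R) = (\<integral>\<^sup>+z. ennreal (?R z) \<partial>lborel)"
        using L_pos M_pos by (intro nn_integral_eq_integral[symmetric] intR) (auto simp: riesz_kernel_nonneg)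
      with R have "ennreal (integral\<^sup>L lborel ?R) \<le> ennreal (M / 2)" by (simp only:)
      then show ?thesis using M_pos by (subst (asm) ennreal_le_iff) auto
    qed
    finally show ?thesis .
  qed
  have "M \<le> M / 2"
    unfolding M_def using nonempty half by (intro cSUP_least) (auto simp: M_def)
  with M_pos show False by simp
qed

lemma kelvin_continuous_radius:
  assumes "0 < r" "z \<noteq> 0"
  shows "continuous (at r) (\<lambda>r. kelvin r z)"
proof -
  have u: "continuous (at y) u" for y
    using continuous by (simp add: continuous_on_eq_continuous_at)
  have "continuous (at r) (\<lambda>r. u (inversion r z))"
    by (rule continuous_within_compose3[OF u]) (unfold inversion_def, intro continuous_intros, use assms in auto)
  then show ?thesis
    unfolding kelvin_transform_def using assms by (intro continuous_intros) auto
qed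

text \<open>
  A point strictly inside the limiting sphere eventually leaves the bad set by the strict comparison and
  continuity in the radius, a point strictly outside leaves it because the balls shrink past it, and the
  sphere is a null set. With \<open>\<rho> = 0\<close>, where there is nothing inside the sphere, this is the start of the
  process.
\<close>

lemma bad_set_measure_tendsto_0:
  fixes R :: "nat \<Rightarrow> real"
  assumes \<rho>: "0 \<le> \<rho>" and strict: "\<And>z. z \<noteq> 0 \<Longrightarrow> norm z < \<rho> \<Longrightarrow> u z < kelvin \<rho> z"
    and R: "R \<longlonglongrightarrow> \<rho>" "\<And>k. \<rho> < R k" "\<And>k. R k \<le> \<rho> + 1"
  shows "(\<lambda>k. measure lborel {z. z \<noteq> 0 \<and> norm z < R k \<and> kelvin (R k) z < u z}) \<longlonglongrightarrow> 0"
proof -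
  define bad where "bad k = {z. z \<noteq> 0 \<and> norm z < R k \<and> kelvin (R k) z < u z}" for k
  have [measurable]: "bad k \<in> sets borel" for k
    unfolding bad_def by measurable
  have "(\<lambda>k. \<integral>z. indicat_real (bad k) z \<partial>lborel) \<longlonglongrightarrow> (\<integral>z. 0 \<partial>(lborel :: (real ^ 'n) measure))"
  proof (rule integral_dominated_convergence[where w = "indicator (ball (0 :: real ^ 'n) (\<rho> + 1))"])
    show "integrable lborel (indicator (ball (0 :: real ^ 'n) (\<rho> + 1)) :: _ \<Rightarrow> real)"
      using emeasure_lborel_ball_finite[of "0 :: real ^ 'n" "\<rho> + 1"] by (intro integrable_real_indicator) auto
    show "AE z in lborel. norm (indicator (bad k) z :: real) \<le> indicator (ball 0 (\<rho> + 1)) z" for k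
      using R(3)[of k] by (intro AE_I2) (auto simp: bad_def indicator_def)
    have "AE z in lborel. z \<notin> sphere (0 :: real ^ 'n) \<rho>"
      by (rule AE_lborel_not_sphere)
    then show "AE z in lborel. (\<lambda>k. indicator (bad k) z :: real) \<longlonglongrightarrow> 0"
    proof eventually_elim
      fix z :: "real ^ 'n"
      assume sph: "z \<notin> sphere 0 \<rho>"
      have "eventually (\<lambda>k. z \<notin> bad k) sequentially"
      proof (cases "z = 0")
        case nz: False
        consider "norm z < \<rho>" | "\<rho> < norm z" using sph by fastforce
        then show ?thesis
        proof cases
          case 1
          then have "0 < \<rho>" by (rule le_less_trans[OF norm_ge_zero])
          then have "(\<lambda>k. kelvin (R k) z) \<longlonglongrightarrow> kelvin \<rho> z"
            using nz by (intro isCont_tendsto_compose[OF kelvin_continuous_radius] R(1)) auto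
          from order_tendstoD(1)[OF this strict[OF nz 1]] show ?thesis
            by eventually_elim (auto simp: bad_def)
        next
          case 2
          from order_tendstoD(2)[OF R(1) this] show ?thesis
            by eventually_elim (auto simp: bad_def)
        qed
      qed (simp add: bad_def)
      then show "(\<lambda>k. indicator (bad k) z :: real) \<longlonglongrightarrow> 0"
        by (rule tendsto_eventually[OF eventually_mono]) simp
    qed
  qed measurable
  then show ?thesis by (simp add: bad_def)
qed

text \<open>
  Otherwise there are radii decreasing to \<open>\<rho>\<close> with nonempty bad sets, although the measures of
  these sets tend to \<open>0\<close>. The constants \<open>L\<close> and \<open>B\<close> can be chosen once for all radii up to
  \<open>\<rho> + 1\<close>, since \<open>u\<close> is continuous and positive.
\<close>

lemma kelvin_comparison_extends:
  assumes \<rho>: "0 \<le> \<rho>" and strict: "\<And>z. z \<noteq> 0 \<Longrightarrow> norm z < \<rho> \<Longrightarrow> u z < kelvin \<rho> z"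
  obtains \<epsilon> where "0 < \<epsilon>"
    and "\<And>r z. \<rho> < r \<Longrightarrow> r < \<rho> + \<epsilon> \<Longrightarrow> z \<noteq> 0 \<Longrightarrow> norm z < r \<Longrightarrow> u z \<le> kelvin r z"
proof (rule ccontr)
  assume "\<not> thesis"
  with that have fail: "\<exists>r z. \<rho> < r \<and> r < \<rho> + \<epsilon> \<and> z \<noteq> 0 \<and> norm z < r \<and> kelvin r z < u z" if "0 < \<epsilon>" for \<epsilon>
    using \<open>0 < \<epsilon>\<close> by (meson not_le)
  have ex: "\<exists>R. \<rho> < R \<and> R < \<rho> + 1 / real (Suc k) \<and> {z. z \<noteq> 0 \<and> norm z < R \<and> kelvin R z < u z} \<noteq> {}" for k
    using fail[of "1 / real (Suc k)"] by fastforce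
  from choice[OF allI[OF ex]] obtain R where R_all: "\<forall>k. \<rho> < R k \<and> R k < \<rho> + 1 / real (Suc k)
      \<and> {z. z \<noteq> 0 \<and> norm z < R k \<and> kelvin (R k) z < u z} \<noteq> {}" by (rule exE)
  have R: "\<rho> < R k" "R k < \<rho> + 1 / real (Suc k)" for k
    using R_all by blast+
  have nonempty: "{z. z \<noteq> 0 \<and> norm z < R k \<and> kelvin (R k) z < u z} \<noteq> {}" for k
    by (rule conjunct2[OF conjunct2[OF spec[OF R_all]]])
  have R1: "R k \<le> \<rho> + 1" for k
  proof -
    have "1 / real (Suc k) \<le> 1" by simp
    then show ?thesis using R(2)[of k] by linarith
  qed
  have lim: "R \<longlonglongrightarrow> \<rho>"
  proof (rule tendsto_sandwich[where f = "\<lambda>_. \<rho>" and h = "\<lambda>k. \<rho> + 1 / real (Suc k)"])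
    show "(\<lambda>k. \<rho> + 1 / real (Suc k)) \<longlonglongrightarrow> \<rho>"
      using LIMSEQ_inverse_real_of_nat_add[of \<rho>] by (simp add: inverse_eq_divide)
  qed (use R in \<open>auto intro!: always_eventually less_imp_le\<close>)
  let ?S = "cball 0 (\<rho> + 1) :: (real ^ 'n) set"
  have cont: "continuous_on ?S u"
    using continuous by (rule continuous_on_subset) simp
  have nonempty_cball: "?S \<noteq> {}" using \<rho> by simp
  obtain B where B: "\<And>z. z \<in> ?S \<Longrightarrow> u z \<le> B"
    using continuous_attains_sup[OF compact_cball nonempty_cball cont] by blast
  have "continuous_on ?S (\<lambda>z. max 1 p * u z powr (p - 1))"
    using positive by (intro continuous_intros cont) (auto simp: less_imp_neq[symmetric])
  from continuous_attains_sup[OF compact_cball nonempty_cball this]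
  obtain L where L: "\<And>z. z \<in> ?S \<Longrightarrow> max 1 p * u z powr (p - 1) \<le> L" by blast
  have "0 < max 1 p * u 0 powr (p - 1)" using positive[of 0] by simp
  then have L_pos: "0 < L" using L[of 0] \<rho> by auto
  then have "0 < 1 / (2 * L)" by simp
  from nn_integral_riesz_kernel_small_set[OF \<alpha>_pos \<alpha>_less this]
  obtain \<delta> where \<delta>: "0 < \<delta>" and small: "\<And>(A :: (real ^ 'n) set) x. A \<in> sets borel \<Longrightarrow> emeasure lborel A \<le> ennreal \<delta> \<Longrightarrow>
           (\<integral>\<^sup>+y. ennreal (riesz_kernel \<alpha> x y) * indicator A y \<partial>lborel) \<le> ennreal (1 / (2 * L))"
    by blast
  from order_tendstoD(2)[OF bad_set_measure_tendsto_0[OF \<rho> strict lim R(1) R1] \<delta>]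
  obtain k where k: "measure lborel {z. z \<noteq> 0 \<and> norm z < R k \<and> kelvin (R k) z < u z} < \<delta>"
    by (meson eventually_sequentially order_refl)
  let ?bad = "{z. z \<noteq> 0 \<and> norm z < R k \<and> kelvin (R k) z < u z}"
  have bad: "?bad \<in> sets borel" by measurable
  have "emeasure lborel ?bad \<le> emeasure lborel (ball (0 :: real ^ 'n) (R k))"
    by (intro emeasure_mono) auto
  then have "emeasure lborel ?bad < \<infinity>"
    using emeasure_lborel_ball_finite by (rule le_less_trans)
  then have "emeasure lborel ?bad \<le> ennreal \<delta>"
    using k by (subst emeasure_eq_ennreal_measure) (auto intro!: ennreal_leI)
  then have "?bad = {}"
    using R1[of k] by (intro kelvin_comparison_small_bad_set[where L = L and B = B] L B small bad) auto
  with nonempty show False by blast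
qed

text \<open>
  Let \<open>\<rho>\<close> be the infimum of the radii at which the comparison fails. It holds below \<open>\<rho>\<close>, hence at \<open>\<rho>\<close> by
  continuity in the radius, hence strictly at \<open>\<rho>\<close>, hence slightly beyond, which contradicts the choice of
  \<open>\<rho>\<close>.
\<close>

lemma kelvin_comparison:
  assumes "0 < r" "z \<noteq> 0" "norm z < r"
  shows "u z \<le> kelvin r z"
proof (rule ccontr)
  define S where "S = {r. 0 < r \<and> (\<exists>z. z \<noteq> 0 \<and> norm z < r \<and> kelvin r z < u z)}"
  assume "\<not> u z \<le> kelvin r z"
  with assms have S: "r \<in> S" by (auto simp: S_def)
  define \<rho> where "\<rho> = Inf S"
  have bdd: "bdd_below S" by (rule bdd_belowI[of _ 0]) (auto simp: S_def)
  have \<rho>: "0 \<le> \<rho>"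
    unfolding \<rho>_def using S by (intro cInf_greatest) (auto simp: S_def)
  have below: "u w \<le> kelvin s w" if "0 < s" "s < \<rho>" "w \<noteq> 0" "norm w < s" for s w
    using that cInf_lower[OF _ bdd, of s] by (force simp: S_def \<rho>_def)
  have at: "u w \<le> kelvin \<rho> w" if w: "w \<noteq> 0" "norm w < \<rho>" for w
  proof -
    have "0 < \<rho>" using w(2) by (rule le_less_trans[OF norm_ge_zero])
    then have "((\<lambda>s. kelvin s w) \<longlongrightarrow> kelvin \<rho> w) (at_left \<rho>)"
      using kelvin_continuous_radius[OF _ w(1)] by (auto simp: continuous_at_imp_continuous_within continuous_within intro: tendsto_within_subset)
    moreover have "eventually (\<lambda>s. s \<in> {norm w <..< \<rho>}) (at_left \<rho>)"
      using w(2) by (rule eventually_at_left_real)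
    then have "eventually (\<lambda>s. u w \<le> kelvin s w) (at_left \<rho>)"
      by eventually_elim (use w below le_less_trans[OF norm_ge_zero] in auto)
    ultimately show ?thesis
      by (intro tendsto_lowerbound) auto
  qed
  obtain \<epsilon> where \<epsilon>: "0 < \<epsilon>"
    and beyond: "\<And>r z. \<rho> < r \<Longrightarrow> r < \<rho> + \<epsilon> \<Longrightarrow> z \<noteq> 0 \<Longrightarrow> norm z < r \<Longrightarrow> u z \<le> kelvin r z"
    using kelvin_comparison_extends[OF \<rho> kelvin_comparison_strict[OF at]] by metis
  have "\<rho> + \<epsilon> \<le> Inf S"
  proof (rule cInf_greatest)
    show "S \<noteq> {}" using S by blast
    fix s assume s: "s \<in> S"
    then obtain w where w: "0 < s" "w \<noteq> 0" "norm w < s" "kelvin s w < u w" by (auto simp: S_def)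
    show "\<rho> + \<epsilon> \<le> s"
      using below[of s w] at[of w] beyond[of s w] w by (metis leD not_less_iff_gr_or_eq not_le)
  qed
  with \<epsilon> show False by (simp add: \<rho>_def)
qed

section \<open>Solutions are constant\<close>

lemma translate: "subcritical_solution \<alpha> p (\<lambda>y. u (a + y))"
proof
  show "continuous_on UNIV (\<lambda>y. u (a + y))"
    by (intro continuous_on_compose2[OF continuous] continuous_intros) auto
  show "has_bochner_integral lborel (\<lambda>y. riesz_kernel \<alpha> x y * u (a + y) powr p) (u (a + x))" for x
  proof -
    have *: "riesz_kernel \<alpha> x y = riesz_kernel \<alpha> (a + x) (a + y)" for y
      by (simp add: riesz_kernel_def)
    have "has_bochner_integral (distr lborel borel ((+) a)) (\<lambda>y. riesz_kernel \<alpha> (a + x) y * u y powr p) (u (a + x))"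
      unfolding lborel_distr_plus by (rule equation)
    then show ?thesis
      unfolding * by (simp add: has_bochner_integral_iff integrable_distr_eq integral_distr)
  qed
qed (use \<alpha>_pos \<alpha>_less p_pos subcritical positive in auto)

text \<open>
  Put the centre \<open>a\<close> at distance \<open>t |y - x|\<close> behind \<open>x\<close> on the line through \<open>y\<close> and \<open>x\<close>. The sphere
  around \<open>a\<close> whose radius is the geometric mean of the distances to \<open>x\<close> and \<open>y\<close> exchanges the two points,
  and its conformal factor at \<open>x\<close> is \<open>sqrt ((1 + t) / t)\<close>, which tends to \<open>1\<close> as \<open>t\<close> grows.
\<close>

lemma le_everywhere: "u x \<le> u y"
proof (cases "x = y")
  case False
  let ?s = "real CARD('n) - \<alpha>"
  define d where "d = y - x"
  have d: "d \<noteq> 0" using False by (simp add: d_def)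
  have le: "u x \<le> sqrt ((1 + t) / t) powr ?s * u y" if t: "0 < t" for t :: real
  proof -
    define a where "a = x - t *\<^sub>R d"
    define r where "r = sqrt (t * (1 + t)) * norm d"
    have r: "0 < r" and r2: "r\<^sup>2 = t * (1 + t) * (norm d)\<^sup>2"
      using t d by (auto simp: r_def power_mult_distrib)
    have "t * t * (norm d)\<^sup>2 < t * (1 + t) * (norm d)\<^sup>2"
      using t d by (intro mult_strict_right_mono) auto
    then have "(norm (t *\<^sub>R d))\<^sup>2 < r\<^sup>2"
      unfolding r2 by (simp add: power_mult_distrib power2_eq_square[of t])
    then have less: "norm (t *\<^sub>R d) < r"
      by (rule power2_less_imp_less) (use r in \<open>rule less_imp_le\<close>)
    interpret a: subcritical_solution \<alpha> p "\<lambda>y. u (a + y)"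
      by (rule translate)
    have "u (a + t *\<^sub>R d) \<le> kelvin_transform \<alpha> r (\<lambda>y. u (a + y)) (t *\<^sub>R d)"
      using t d less by (intro a.kelvin_comparison r) auto
    also have "\<dots> = (r / norm (t *\<^sub>R d)) powr ?s * u (a + inversion r (t *\<^sub>R d))"
      by (simp add: kelvin_transform_def)
    also have "r / norm (t *\<^sub>R d) = sqrt ((1 + t) / t)"
    proof -
      have "t * (1 + t) = t\<^sup>2 * ((1 + t) / t)"
        using t by (simp add: power2_eq_square)
      then have "sqrt (t * (1 + t)) = t * sqrt ((1 + t) / t)"
        using t by (simp only: real_sqrt_mult real_sqrt_abs)
      then show ?thesis using t d by (simp add: r_def)
    qed
    also have "inversion r (t *\<^sub>R d) = (1 + t) *\<^sub>R d"
      using t d by (simp add: inversion_def r2 power_mult_distrib) (simp add: power2_eq_square)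
    finally show ?thesis by (simp add: a_def d_def algebra_simps)
  qed
  have lim: "((\<lambda>t. sqrt ((1 + t) / t) powr ?s * u y) \<longlongrightarrow> 1 powr ?s * u y) at_top"
  proof (intro tendsto_intros)
    have "((\<lambda>t::real. 1 / t + 1) \<longlongrightarrow> 0 + 1) at_top"
      by (intro tendsto_intros tendsto_divide_0[OF tendsto_const] filterlim_at_top_imp_at_infinity filterlim_ident)
    moreover have "eventually (\<lambda>t::real. 1 / t + 1 = (1 + t) / t) at_top"
      using eventually_gt_at_top[of 0] by eventually_elim (simp add: field_simps)
    ultimately have "((\<lambda>t::real. (1 + t) / t) \<longlongrightarrow> 1) at_top"
      by (auto intro: Lim_transform_eventually)
    from tendsto_real_sqrt[OF this] show "((\<lambda>t::real. sqrt ((1 + t) / t)) \<longlongrightarrow> 1) at_top"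
      by simp
  qed auto
  have "eventually (\<lambda>t. u x \<le> sqrt ((1 + t) / t) powr ?s * u y) at_top"
    using eventually_gt_at_top[of 0] by eventually_elim (rule le)
  then have "u x \<le> 1 powr ?s * u y"
    by (rule tendsto_lowerbound[OF lim]) simp
  then show ?thesis by simp
qed simp

lemma equal_everywhere: "u x = u y"
  using le_everywhere by (intro antisym)

end

section \<open>Growth over large balls\<close>

lemma false_if_volume_le_power:
  fixes a b c m :: real
  assumes \<alpha>: "0 < \<alpha>" and a: "0 < a" and le: "\<And>R. 0 < R \<Longrightarrow> a * R powr m \<le> b * R powr (m - \<alpha>)"
  shows False
proof -
  have "0 < a * 1 powr m" using a by simp
  then have b: "0 < b" using le[of 1] a by simp
  \<comment> \<open>At this radius the left-hand side is twice the right-hand side.\<close>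
  define R where "R = (2 * b / a) powr (1 / \<alpha>)"
  have R: "0 < R" "R powr \<alpha> = 2 * b / a"
    using a b \<alpha> by (auto simp: R_def powr_powr)
  have "R powr m = R powr \<alpha> * R powr (m - \<alpha>)"
    by (simp add: powr_add[symmetric])
  then have "2 * b * R powr (m - \<alpha>) \<le> b * R powr (m - \<alpha>)"
    using le[OF R(1)] a by (simp add: R(2) field_simps)
  moreover have "0 < b * R powr (m - \<alpha>)" using b R by simp
  ultimately show False by simp
qed

lemma emeasure_ball_powr:
  fixes x :: "real ^ 'n::finite"
  assumes "0 < R"
  shows "emeasure lborel (ball x R) = ennreal (measure lborel (ball (0 :: real ^ 'n) 1) * R powr real CARD('n))"
  using emeasure_lborel_ball_finite[of x R] content_ball_conv_unit_ball[of R x] assms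
  by (subst emeasure_eq_ennreal_measure) (auto simp: powr_realpow mult.commute)

text \<open>
  On the ball of radius \<open>R\<close> the kernel with pole \<open>0\<close> is at least \<open>R powr (\<alpha> - n)\<close>, and the potential
  at \<open>0\<close> is finite.
\<close>

lemma nn_integral_source_ball_le:
  fixes u :: "real ^ 'n::finite \<Rightarrow> real"
  assumes \<alpha>: "\<alpha> < real CARD('n)" and u: "regular_positive_solution \<alpha> p u" and R: "0 < R"
  shows "(\<integral>\<^sup>+y. ennreal (u y powr p) * indicator (ball 0 R) y \<partial>lebesgue) \<le> ennreal (u 0 * R powr (real CARD('n) - \<alpha>))"
proof -
  let ?s = "real CARD('n) - \<alpha>"
  have [measurable]: "u \<in> borel_measurable lebesgue" and pos: "\<And>y. 0 < u y"
    and eq: "has_bochner_integral lebesgue (\<lambda>y. riesz_kernel \<alpha> 0 y * u y powr p) (u 0)"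
    using u by (auto simp: regular_positive_solution_def)
  have "AE y in lebesgue. y \<noteq> (0 :: real ^ 'n)"
    by (rule AE_completion[OF AE_lborel_singleton])
  then have "AE y in lebesgue. ennreal (u y powr p) * indicator (ball 0 R) y
      \<le> ennreal (R powr ?s) * ennreal (riesz_kernel \<alpha> 0 y * u y powr p)"
  proof eventually_elim
    fix y :: "real ^ 'n" assume y: "y \<noteq> 0"
    show "ennreal (u y powr p) * indicator (ball 0 R) y \<le> ennreal (R powr ?s) * ennreal (riesz_kernel \<alpha> 0 y * u y powr p)"
    proof (cases "y \<in> ball 0 R")
      case True
      then have "R powr (\<alpha> - real CARD('n)) \<le> riesz_kernel \<alpha> 0 y"
        using y by (intro riesz_kernel_ge \<alpha>) auto
      then have "R powr ?s * R powr (\<alpha> - real CARD('n)) * u y powr p \<le> R powr ?s * riesz_kernel \<alpha> 0 y * u y powr p"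
        by (intro mult_right_mono mult_left_mono) auto
      then have "u y powr p \<le> R powr ?s * (riesz_kernel \<alpha> 0 y * u y powr p)"
        using R by (simp add: powr_add[symmetric] mult.assoc)
      with True show ?thesis
        by (simp add: ennreal_mult[symmetric] riesz_kernel_nonneg ennreal_leI)
    qed simp
  qed
  then have "(\<integral>\<^sup>+y. ennreal (u y powr p) * indicator (ball 0 R) y \<partial>lebesgue)
      \<le> (\<integral>\<^sup>+y. ennreal (R powr ?s) * ennreal (riesz_kernel \<alpha> 0 y * u y powr p) \<partial>lebesgue)"
    by (rule nn_integral_mono_AE)
  also have "\<dots> = ennreal (R powr ?s) * (\<integral>\<^sup>+y. ennreal (riesz_kernel \<alpha> 0 y * u y powr p) \<partial>lebesgue)"
    using eq by (intro nn_integral_cmult) (auto simp: has_bochner_integral_iff)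
  also have "(\<integral>\<^sup>+y. ennreal (riesz_kernel \<alpha> 0 y * u y powr p) \<partial>lebesgue) = ennreal (u 0)"
    using eq nn_integral_eq_integral[of lebesgue "\<lambda>y. riesz_kernel \<alpha> 0 y * u y powr p"]
    by (auto simp: has_bochner_integral_iff riesz_kernel_nonneg)
  finally show ?thesis
    using pos[of 0] by (simp add: ennreal_mult[symmetric] mult.commute)
qed

lemma not_regular_positive_solution_constant:
  fixes u :: "real ^ 'n::finite \<Rightarrow> real"
  assumes \<alpha>: "0 < \<alpha>" "\<alpha> < real CARD('n)" and const: "\<And>y. u y = u 0"
  shows "\<not> regular_positive_solution \<alpha> p u"
proof
  assume u: "regular_positive_solution \<alpha> p u"
  let ?\<omega> = "measure lborel (ball (0 :: real ^ 'n) 1)"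
  have \<omega>: "0 < ?\<omega>" by (rule content_ball_pos) simp
  have pos: "0 < u 0" using u by (simp add: regular_positive_solution_def)
  show False
  proof (rule false_if_volume_le_power[OF \<alpha>(1)])
    show "0 < u 0 powr p * ?\<omega>" using pos \<omega> by simp
    fix R :: real assume R: "0 < R"
    have "(\<integral>\<^sup>+y. ennreal (u y powr p) * indicator (ball 0 R) y \<partial>lebesgue) = ennreal (u 0 powr p) * emeasure lborel (ball (0 :: real ^ 'n) R)"
      by (subst const) (simp add: nn_integral_cmult_indicator)
    also have "\<dots> = ennreal (u 0 powr p * ?\<omega> * R powr real CARD('n))"
      using \<omega> by (simp add: emeasure_ball_powr[OF R] ennreal_mult[symmetric] mult.assoc)
    finally show "u 0 powr p * ?\<omega> * R powr real CARD('n) \<le> u 0 * R powr (real CARD('n) - \<alpha>)"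
      using nn_integral_source_ball_le[OF \<alpha>(2) u R] pos by (simp add: ennreal_le_iff)
  qed
qed

text \<open>
  The mean of the kernel over a ball around \<open>0\<close> is comparable to its value at \<open>0\<close>, wherever the pole \<open>y\<close>
  is: if \<open>norm y \<ge> 2 R\<close>, then \<open>norm (x - y) \<ge> norm y / 2\<close> on the ball; otherwise the ball is contained
  in the one of radius \<open>3 R\<close> around the pole, and \<open>riesz_kernel \<alpha> 0 y \<ge> (2 R) powr (\<alpha> - n)\<close>.
\<close>

lemma nn_integral_riesz_kernel_ball_le_kernel:
  assumes \<alpha>: "0 < \<alpha>" "\<alpha> < real CARD('n::finite)"
  obtains C where "0 < C"
    and "\<And>R (y :: real ^ 'n). 0 < R \<Longrightarrow> y \<noteq> 0 \<Longrightarrow>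
      (\<integral>\<^sup>+x. ennreal (riesz_kernel \<alpha> x y) * indicator (ball 0 R) x \<partial>lborel) \<le> ennreal (C * R powr real CARD('n) * riesz_kernel \<alpha> 0 y)"
proof -
  let ?n = "real CARD('n)"
  let ?\<omega> = "measure lborel (ball (0 :: real ^ 'n) 1)"
  have \<omega>: "0 < ?\<omega>" by (rule content_ball_pos) simp
  obtain C where C: "0 < C" and ball: "\<And>(x :: real ^ 'n) r. 0 < r \<Longrightarrow>
      (\<integral>\<^sup>+y. ennreal (riesz_kernel \<alpha> x y) * indicator (ball x r) y \<partial>lborel) \<le> ennreal (C * r powr \<alpha>)"
    using nn_integral_riesz_kernel_ball[OF \<alpha>] by blast
  let ?C = "2 powr (?n - \<alpha>) * (C * 3 powr \<alpha> + ?\<omega>)"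
  show ?thesis
  proof
    show "0 < ?C" using C \<omega> by (simp add: add_pos_pos)
    fix R :: real and y :: "real ^ 'n"
    assume R: "0 < R" and y: "y \<noteq> 0"
    have k0: "0 < riesz_kernel \<alpha> 0 y" using y by (intro riesz_kernel_pos) auto
    show "(\<integral>\<^sup>+x. ennreal (riesz_kernel \<alpha> x y) * indicator (ball 0 R) x \<partial>lborel) \<le> ennreal (?C * R powr ?n * riesz_kernel \<alpha> 0 y)"
    proof (cases "norm y < 2 * R")
      case True
      have "(\<integral>\<^sup>+x. ennreal (riesz_kernel \<alpha> x y) * indicator (ball 0 R) x \<partial>lborel)
          \<le> (\<integral>\<^sup>+x. ennreal (riesz_kernel \<alpha> y x) * indicator (ball y (3 * R)) x \<partial>lborel)"
      proof (intro nn_integral_mono)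
        fix x :: "real ^ 'n"
        have "x \<in> ball y (3 * R)" if "x \<in> ball 0 R"
          using that True norm_triangle_ineq4[of y x] by (simp add: dist_norm)
        then show "ennreal (riesz_kernel \<alpha> x y) * indicator (ball 0 R) x \<le> ennreal (riesz_kernel \<alpha> y x) * indicator (ball y (3 * R)) x"
          by (auto simp: indicator_def riesz_kernel_commute[of \<alpha> x y])
      qed
      also have "\<dots> \<le> ennreal (C * (3 * R) powr \<alpha>)" using R by (intro ball) auto
      also have "C * (3 * R) powr \<alpha> \<le> ?C * R powr ?n * riesz_kernel \<alpha> 0 y"
      proof -
        have "C * (3 * R) powr \<alpha> = 2 powr (?n - \<alpha>) * (C * 3 powr \<alpha>) * R powr ?n * (2 * R) powr (\<alpha> - ?n)"
        proof -
          have one: "2 powr (\<alpha> - ?n) * 2 powr (?n - \<alpha>) = (1 :: real)" and R\<alpha>: "R powr ?n * R powr (\<alpha> - ?n) = R powr \<alpha>"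
            by (simp_all add: powr_add[symmetric])
          have rearrange: "2 powr (?n - \<alpha>) * (C * 3 powr \<alpha>) * R powr ?n * (2 * R) powr (\<alpha> - ?n)
              = C * 3 powr \<alpha> * (R powr ?n * R powr (\<alpha> - ?n)) * (2 powr (\<alpha> - ?n) * 2 powr (?n - \<alpha>))"
            by (simp only: powr_mult mult_ac)
          show ?thesis
            unfolding rearrange one R\<alpha> by (simp add: powr_mult)
        qed
        also have "\<dots> \<le> ?C * R powr ?n * riesz_kernel \<alpha> 0 y"
          using True y C \<omega> riesz_kernel_ge[OF \<alpha>(2), of 0 y "2 * R"]
          by (intro mult_mono) auto
        finally show ?thesis .
      qed
      finally show ?thesis by (simp add: ennreal_leI)
    next
      case False
      have "(\<integral>\<^sup>+x. ennreal (riesz_kernel \<alpha> x y) * indicator (ball 0 R) x \<partial>lborel)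
          \<le> (\<integral>\<^sup>+x. ennreal (2 powr (?n - \<alpha>) * riesz_kernel \<alpha> 0 y) * indicator (ball (0 :: real ^ 'n) R) x \<partial>lborel)"
      proof (intro nn_integral_mono)
        fix x :: "real ^ 'n"
        have "riesz_kernel \<alpha> x y \<le> 2 powr (?n - \<alpha>) * riesz_kernel \<alpha> 0 y" if "x \<in> ball 0 R"
        proof -
          have "norm y / 2 \<le> norm (x - y)"
            using that False norm_triangle_ineq2[of y x] by (simp add: norm_minus_commute)
          then have "riesz_kernel \<alpha> x y \<le> (norm y / 2) powr (\<alpha> - ?n)"
            using y by (intro riesz_kernel_antimono \<alpha>) auto
          also have "\<dots> = 2 powr (?n - \<alpha>) * riesz_kernel \<alpha> 0 y"
            using powr_minus_divide[of "norm y" "?n - \<alpha>"] powr_minus_divide[of 2 "?n - \<alpha>"]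
            by (simp add: powr_divide riesz_kernel_def)
          finally show ?thesis .
        qed
        then show "ennreal (riesz_kernel \<alpha> x y) * indicator (ball 0 R) x \<le> ennreal (2 powr (?n - \<alpha>) * riesz_kernel \<alpha> 0 y) * indicator (ball 0 R) x"
          by (cases "x \<in> ball 0 R") (auto intro: ennreal_leI)
      qed
      also have "\<dots> = ennreal (2 powr (?n - \<alpha>) * riesz_kernel \<alpha> 0 y * (?\<omega> * R powr ?n))"
        using k0 by (simp add: nn_integral_cmult_indicator emeasure_ball_powr[OF R] ennreal_mult[symmetric])
      also have "\<dots> \<le> ennreal (?C * R powr ?n * riesz_kernel \<alpha> 0 y)"
        using k0 C by (intro ennreal_leI) (simp add: algebra_simps)
      finally show ?thesis .
    qed
  qed
qed

lemma sigma_finite_completion: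
  assumes "sigma_finite_measure M"
  shows "sigma_finite_measure (completion M)"
proof
  obtain A where "countable A" "A \<subseteq> sets M" "\<Union>A = space M" "\<forall>a\<in>A. emeasure M a \<noteq> \<infinity>"
    using sigma_finite_measure.sigma_finite_countable[OF assms] by blast
  then show "\<exists>A. countable A \<and> A \<subseteq> sets (completion M) \<and> \<Union>A = space (completion M)
      \<and> (\<forall>a\<in>A. emeasure (completion M) a \<noteq> \<infinity>)"
    by (intro exI[of _ A]) (auto simp: sets_completionI_sets)
qed

text \<open>
  Integrate the equation over the ball, exchange the integrals by Tonelli, and estimate the inner
  integral by the kernel with pole \<open>0\<close>; what remains is the equation at \<open>0\<close>.
\<close>

lemma nn_integral_solution_ball_le:
  assumes \<alpha>: "0 < \<alpha>" "\<alpha> < real CARD('n::finite)"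
  obtains C where "0 < C"
    and "\<And>(u :: real ^ 'n \<Rightarrow> real) p R. regular_positive_solution \<alpha> p u \<Longrightarrow> 0 < R \<Longrightarrow>
      (\<integral>\<^sup>+x. ennreal (u x) * indicator (ball 0 R) x \<partial>lebesgue) \<le> ennreal (C * R powr real CARD('n) * u 0)"
proof -
  let ?n = "real CARD('n)"
  obtain C where C: "0 < C" and ball: "\<And>R (y :: real ^ 'n). 0 < R \<Longrightarrow> y \<noteq> 0 \<Longrightarrow>
      (\<integral>\<^sup>+x. ennreal (riesz_kernel \<alpha> x y) * indicator (ball 0 R) x \<partial>lborel) \<le> ennreal (C * R powr ?n * riesz_kernel \<alpha> 0 y)"
    using nn_integral_riesz_kernel_ball_le_kernel[OF \<alpha>] by blast
  show ?thesis
  proof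
    show "0 < C" by (rule C)
    fix u :: "real ^ 'n \<Rightarrow> real" and p R :: real
    assume u: "regular_positive_solution \<alpha> p u" and R: "0 < R"
    have [measurable]: "u \<in> borel_measurable lebesgue" and pos: "\<And>y. 0 < u y"
      and eq: "\<And>x. has_bochner_integral lebesgue (\<lambda>y. riesz_kernel \<alpha> x y * u y powr p) (u x)"
      using u by (auto simp: regular_positive_solution_def)
    have [measurable]: "(\<lambda>y :: real ^ 'n. y) \<in> borel_measurable lebesgue"
      using id_borel_measurable_lebesgue by (simp add: id_def)
    have nn_eq: "ennreal (u x) = (\<integral>\<^sup>+y. ennreal (riesz_kernel \<alpha> x y * u y powr p) \<partial>lebesgue)" for x
      using eq[of x] nn_integral_eq_integral[of lebesgue "\<lambda>y. riesz_kernel \<alpha> x y * u y powr p"]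
      by (auto simp: has_bochner_integral_iff riesz_kernel_nonneg)
    interpret L: sigma_finite_measure "lebesgue :: (real ^ 'n) measure"
      by (rule sigma_finite_completion) standard
    interpret P: pair_sigma_finite "lebesgue :: (real ^ 'n) measure" "lebesgue :: (real ^ 'n) measure" ..
    have "(\<integral>\<^sup>+x. ennreal (u x) * indicator (ball 0 R) x \<partial>lebesgue)
        = (\<integral>\<^sup>+x. (\<integral>\<^sup>+y. ennreal (u y powr p) * (ennreal (riesz_kernel \<alpha> x y) * indicator (ball 0 R) x) \<partial>lebesgue) \<partial>lebesgue)"
      unfolding nn_eq
      by (intro nn_integral_cong, subst nn_integral_multc[symmetric])
         (measurable, auto intro!: nn_integral_cong simp: ennreal_mult riesz_kernel_nonneg mult_ac)
    also have "\<dots> = (\<integral>\<^sup>+y. (\<integral>\<^sup>+x. ennreal (u y powr p) * (ennreal (riesz_kernel \<alpha> x y) * indicator (ball 0 R) x) \<partial>lebesgue) \<partial>lebesgue)"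
      by (rule P.Fubini') measurable
    also have "\<dots> = (\<integral>\<^sup>+y. ennreal (u y powr p) * (\<integral>\<^sup>+x. ennreal (riesz_kernel \<alpha> x y) * indicator (ball 0 R) x \<partial>lebesgue) \<partial>lebesgue)"
      by (intro nn_integral_cong nn_integral_cmult) measurable
    also have "\<dots> \<le> (\<integral>\<^sup>+y. ennreal (C * R powr ?n) * ennreal (riesz_kernel \<alpha> 0 y * u y powr p) \<partial>lebesgue)"
    proof (rule nn_integral_mono_AE)
      have "AE y in lebesgue. y \<noteq> (0 :: real ^ 'n)"
        by (rule AE_completion[OF AE_lborel_singleton])
      then show "AE y in lebesgue. ennreal (u y powr p) * (\<integral>\<^sup>+x. ennreal (riesz_kernel \<alpha> x y) * indicator (ball 0 R) x \<partial>lebesgue)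
          \<le> ennreal (C * R powr ?n) * ennreal (riesz_kernel \<alpha> 0 y * u y powr p)"
      proof eventually_elim
        fix y :: "real ^ 'n" assume y: "y \<noteq> 0"
        have "ennreal (u y powr p) * (\<integral>\<^sup>+x. ennreal (riesz_kernel \<alpha> x y) * indicator (ball 0 R) x \<partial>lebesgue)
            \<le> ennreal (u y powr p) * ennreal (C * R powr ?n * riesz_kernel \<alpha> 0 y)"
          unfolding nn_integral_completion by (intro mult_left_mono ball R y) simp
        also have "\<dots> = ennreal (C * R powr ?n) * ennreal (riesz_kernel \<alpha> 0 y * u y powr p)"
          using C by (simp add: ennreal_mult[symmetric] riesz_kernel_nonneg mult_ac)
        finally show "ennreal (u y powr p) * (\<integral>\<^sup>+x. ennreal (riesz_kernel \<alpha> x y) * indicator (ball 0 R) x \<partial>lebesgue)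
          \<le> ennreal (C * R powr ?n) * ennreal (riesz_kernel \<alpha> 0 y * u y powr p)" .
      qed
    qed
    also have "\<dots> = ennreal (C * R powr ?n) * ennreal (u 0)"
      unfolding nn_eq by (rule nn_integral_cmult) measurable
    also have "\<dots> = ennreal (C * R powr ?n * u 0)"
      using C pos[of 0] by (simp add: ennreal_mult[symmetric])
    finally show "(\<integral>\<^sup>+x. ennreal (u x) * indicator (ball 0 R) x \<partial>lebesgue) \<le> ennreal (C * R powr ?n * u 0)" .
  qed
qed

text \<open>
  For \<open>p \<le> 0\<close> and any level \<open>L\<close> one has \<open>u + L powr (1 - p) * u powr p \<ge> L\<close>, by the first term where
  \<open>u \<ge> L\<close> and by the second elsewhere. Integrating over a ball, \<open>L\<close> is taken so large that the mean of
  \<open>u\<close> absorbs only half of the right-hand side; the other term grows too slowly to pay for the rest.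
\<close>

lemma not_regular_positive_solution_nonpos_exponent:
  fixes u :: "real ^ 'n::finite \<Rightarrow> real"
  assumes \<alpha>: "0 < \<alpha>" "\<alpha> < real CARD('n)" and p: "p \<le> 0"
  shows "\<not> regular_positive_solution \<alpha> p u"
proof
  assume u: "regular_positive_solution \<alpha> p u"
  let ?n = "real CARD('n)"
  let ?\<omega> = "measure lborel (ball (0 :: real ^ 'n) 1)"
  have \<omega>: "0 < ?\<omega>" by (rule content_ball_pos) simp
  have [measurable]: "u \<in> borel_measurable lebesgue" and pos: "\<And>y. 0 < u y"
    using u by (auto simp: regular_positive_solution_def)
  obtain C where C: "0 < C" and avg: "\<And>(u :: real ^ 'n \<Rightarrow> real) p R. regular_positive_solution \<alpha> p u \<Longrightarrow> 0 < R \<Longrightarrow>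
      (\<integral>\<^sup>+x. ennreal (u x) * indicator (ball 0 R) x \<partial>lebesgue) \<le> ennreal (C * R powr ?n * u 0)"
    using nn_integral_solution_ball_le[OF \<alpha>] by blast
  define L where "L = 2 * C * u 0 / ?\<omega>"
  have L: "0 < L" "L * ?\<omega> = 2 * C * u 0" using C \<omega> pos[of 0] by (auto simp: L_def)
  have pointwise: "L \<le> u y + L powr (1 - p) * u y powr p" for y
  proof (cases "L \<le> u y")
    case False
    then have "L powr p \<le> u y powr p" using pos[of y] p by (intro powr_mono2') auto
    then have "L powr (1 - p) * L powr p \<le> L powr (1 - p) * u y powr p"
      by (intro mult_left_mono) auto
    moreover have "L powr (1 - p) * L powr p = L" using L by (simp add: powr_add[symmetric])
    ultimately show ?thesis using pos[of y] by simp
  next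
    case True
    then show ?thesis by (simp add: add_increasing2)
  qed
  show False
  proof (rule false_if_volume_le_power[OF \<alpha>(1)])
    show "0 < C * u 0" using C pos[of 0] by simp
    fix R :: real assume R: "0 < R"
    have [measurable]: "ball (0 :: real ^ 'n) R \<in> sets lebesgue" by simp
    have m: "(\<lambda>y. ennreal (u y) * indicator (ball 0 R) y) \<in> borel_measurable lebesgue"
        "(\<lambda>y. ennreal (u y powr p) * indicator (ball 0 R) y) \<in> borel_measurable lebesgue"
      by measurable
    have "ennreal (L * ?\<omega> * R powr ?n) = (\<integral>\<^sup>+y. ennreal L * indicator (ball (0 :: real ^ 'n) R) y \<partial>lebesgue)"
      using L(1) \<omega> by (simp add: nn_integral_cmult_indicator emeasure_ball_powr[OF R] ennreal_mult[symmetric] mult.assoc)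
    also have "\<dots> \<le> (\<integral>\<^sup>+y. ennreal (u y) * indicator (ball 0 R) y
        + ennreal (L powr (1 - p)) * (ennreal (u y powr p) * indicator (ball 0 R) y) \<partial>lebesgue)"
    proof (intro nn_integral_mono)
      fix y :: "real ^ 'n"
      show "ennreal L * indicator (ball 0 R) y \<le> ennreal (u y) * indicator (ball 0 R) y
        + ennreal (L powr (1 - p)) * (ennreal (u y powr p) * indicator (ball 0 R) y)"
        using pointwise[of y] pos[of y]
        by (cases "y \<in> ball 0 R") (auto simp: ennreal_mult[symmetric] ennreal_plus[symmetric] ennreal_leI simp del: ennreal_plus)
    qed
    also have "\<dots> = (\<integral>\<^sup>+y. ennreal (u y) * indicator (ball 0 R) y \<partial>lebesgue)
        + ennreal (L powr (1 - p)) * (\<integral>\<^sup>+y. ennreal (u y powr p) * indicator (ball 0 R) y \<partial>lebesgue)"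
      using m by (simp add: nn_integral_add nn_integral_cmult)
    also have "\<dots> \<le> ennreal (C * R powr ?n * u 0) + ennreal (L powr (1 - p)) * ennreal (u 0 * R powr (?n - \<alpha>))"
      using avg[OF u R] nn_integral_source_ball_le[OF \<alpha>(2) u R] by (intro add_mono mult_left_mono) auto
    also have "\<dots> = ennreal (C * R powr ?n * u 0 + L powr (1 - p) * (u 0 * R powr (?n - \<alpha>)))"
      using C pos[of 0] by (simp add: ennreal_mult[symmetric] ennreal_plus[symmetric] del: ennreal_plus)
    finally have "L * ?\<omega> * R powr ?n \<le> C * R powr ?n * u 0 + L powr (1 - p) * (u 0 * R powr (?n - \<alpha>))"
      using C pos[of 0] by (subst (asm) ennreal_le_iff) auto
    then show "C * u 0 * R powr ?n \<le> L powr (1 - p) * u 0 * R powr (?n - \<alpha>)"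
      unfolding L(2) by (simp add: algebra_simps)
  qed
qed

theorem theorem1:
  fixes \<alpha> p :: real
  assumes "0 < \<alpha>" and "\<alpha> < real CARD('n::finite)"
    and "p < (real CARD('n) + \<alpha>) / (real CARD('n) - \<alpha>)"
  shows "\<not> (\<exists>u :: real ^ 'n \<Rightarrow> real. regular_positive_solution \<alpha> p u)"
proof
  assume "\<exists>u :: real ^ 'n \<Rightarrow> real. regular_positive_solution \<alpha> p u"
  then obtain u :: "real ^ 'n \<Rightarrow> real" where u: "regular_positive_solution \<alpha> p u" by blast
  have p: "0 < p"
    using not_regular_positive_solution_nonpos_exponent[where u = u, OF assms(1,2)] u by (metis not_le)
  have cont: "continuous_on UNIV u"
    by (rule continuous_on_regular_positive_solution[OF assms(1,2) p u])
  have [measurable]: "u \<in> borel_measurable borel"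
    by (rule borel_measurable_continuous_onI[OF cont])
  interpret subcritical_solution \<alpha> p u
  proof
    fix x
    have "has_bochner_integral lebesgue (\<lambda>y. riesz_kernel \<alpha> x y * u y powr p) (u x)"
      using u by (simp add: regular_positive_solution_def)
    then show "has_bochner_integral lborel (\<lambda>y. riesz_kernel \<alpha> x y * u y powr p) (u x)"
      by (simp add: has_bochner_integral_iff integrable_completion integral_completion)
    show "0 < u x" using u by (simp add: regular_positive_solution_def)
  qed (use assms p cont in auto)
  show False
    using not_regular_positive_solution_constant[where u = u, OF assms(1,2) equal_everywhere, of p] u by blast
qed

end
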